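(* Let $\theta\in\mathbb{R}$. The bijection $\overline{\varphi}_\theta\colon\mathrm{Con}(A_\theta,\delta)\to\mathrm{Con}(A,\delta)$, obtained by restricting $\overline{\varphi}_\theta\colon\Omega^1(A_\theta)\to\Omega^1(A)_\theta$, $a\,\mathrm{d}_\theta a'\mapsto a\star_\theta\mathrm{d}a'$, preserves infinitesimal gauge transformations, i.e. $$\overline{\varphi}_\theta\big(\omega_\theta\,{}_\theta\!\triangleleft\zeta\big)=\overline{\varphi}_\theta(\omega_\theta)\triangleleft\zeta$$ for all $\zeta\in E_A(\mathfrak h)=E_{A_\theta}(\mathfrak h)$ and all $\omega_\theta\in\mathrm{Con}(A_\theta,\delta)$.
   Context: Algebras are associative and unital over $\mathbb{C}$, $\otimes=\otimes_{\mathbb{C}}$. Sweedler notation: $\delta(a)=a_{\underline{0}}\otimes a_{\underline{1}}$ for right coactions, $\rho(a)=a_{\underline{-1}}\otimes a_{\underline{0}}$ for left coactions. $A=\mathcal{O}(\mathbb{S}^3)$ is the commutative $\ast$-algebra generated by $z_1,z_2$ modulo the $\ast$-ideal generated by the relation $z_1^\ast z_1+z_2^\ast z_2=\mathbf{1}$. $H=\mathcal{O}(U(1))$ is the commutative $\ast$-Hopf algebra generated by $t$ with $t^\ast t=\mathbf{1}$, $\Delta(t)=t\otimes t$, $\epsilon(t)=1$, $S(t)=t^\ast$. $\delta\colon A\to A\otimes H$ is the right $H$-coaction ($\ast$-algebra map) with $\delta(z_i)=z_i\otimes t$, $\delta(z_i^\ast)=z_i^\ast\otimes t^\ast$. $K=\mathcal{O}(\mathbb{T}^2)$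 is the Hopf algebra with basis $\{t_{\mathbf m}:\mathbf m\in\mathbb{Z}^2\}$, $t_{\mathbf m}t_{\mathbf m'}=t_{\mathbf m+\mathbf m'}$, $\Delta(t_{\mathbf m})=t_{\mathbf m}\otimes t_{\mathbf m}$, $\epsilon(t_{\mathbf m})=1$, $S(t_{\mathbf m})=t_{\mathbf m}^\ast=t_{-\mathbf m}$. $\rho\colon A\to K\otimes A$ is the left $K$-coaction ($\ast$-algebra map) with $\rho(z_1)=t_{(1,0)}\otimes z_1$, $\rho(z_2)=t_{(0,1)}\otimes z_2$, $\rho(z_1^\ast)=t_{(-1,0)}\otimes z_1^\ast$, $\rho(z_2^\ast)=t_{(0,-1)}\otimes z_2^\ast$. For $\theta\in\mathbb{R}$ let $\sigma_\theta(t_{\mathbf m}\otimes t_{\mathbf m'})=\exp(\pi i\theta(m_1m_2'-m_2m_1'))$ and $R_\theta=\sigma_\theta^{-2}$, i.e. $R_\theta(t_{\mathbf m}\otimes t_{\mathbf m'})=\exp(-2\pi i\theta(m_1m_2'-m_2m_1'))$. $A_\theta$ is the same vector space with the same unit, involution and coactions, and product $a\star_\theta a'=\sigma_\theta(a_{\underline{-1}}\otimes a'_{\underline{-1}})\,a_{\underline 0}a'_{\underline 0}$. $B:=A^{\mathrm{co}H}=\{a\in A:\delta(a)=a\otimes\mathbf 1\}$ coincides with $A_\theta^{\mathrm{co}H}$ as an algebra. Kähler forms: $\Omega^1(A)=\ker\mu_A/(\ker\mu_A)^2$ (square in the tensor product algebra $A\otimes A$), $\mathrm{d}a=[\mathbf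 1\otimes a-a\otimes\mathbf 1]$. $\Omega^1(A_\theta)=\ker\mu_{A_\theta}/(\ker\mu_{A_\theta})^2$, where the square is formed in $A_\theta\otimes A_\theta$ with the braided tensor algebra product $(a\otimes a')(\tilde a\otimes\tilde a')=R_\theta(\tilde a_{\underline{-1}}\otimes a'_{\underline{-1}})(a\star_\theta\tilde a_{\underline 0})\otimes(a'_{\underline 0}\star_\theta\tilde a')$; $\mathrm{d}_\theta a=[\mathbf 1\otimes a-a\otimes\mathbf 1]$. Both carry induced left $K$- and right $H$-coactions. $\Omega^1(A)_\theta$ is $\Omega^1(A)$ (same vector space and coactions) with left $A_\theta$-action $a\star_\theta\lambda=\sigma_\theta(a_{\underline{-1}}\otimes\lambda_{\underline{-1}})a_{\underline 0}\lambda_{\underline 0}$. $(\Omega^\bullet(A_\theta),\wedge_\theta,\mathrm{d}_\theta)$ is the differential graded algebra given by the braided exterior algebra of the $A_\theta$-bimodule $\Omega^1(A_\theta)$: $\lambda\wedge_\theta\lambda'=(-1)^{nm}R_\theta(\lambda'_{\underline{-1}}\otimes\lambda_{\underline{-1}})\,\lambda'_{\underline 0}\wedge_\theta\lambda_{\underline 0}$ for $\lambda,\lambda'$ of degrees $n,m$, with the Leibniz convention $\mathrm{d}_\theta(\lambda\wedge_\theta\lambda')=\lambda\wedge_\theta\mathrm{d}_\theta\lambda'+(-1)^m(\mathrm{d}_\theta\lambda)\wedge_\theta\lambda'$ for $\lambda'$ of degree $m$. Connections: let $X\colon H\to\mathbb{C}$, $X(t^n)=n$. With $\overline{\mathrm{ver}}^X(a\,\mathrm{d}a')=a\,a'_{\underline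 0}X(a'_{\underline 1})$ and $\overline{\mathrm{ver}}^X_\theta(a\,\mathrm{d}_\theta a')=a\star_\theta a'_{\underline 0}X(a'_{\underline 1})$, set $\mathrm{Con}(A,\delta)=\{\omega\in\Omega^1(A)^{\mathrm{co}H}:\overline{\mathrm{ver}}^X(\omega)=\mathbf 1\}$ and $\mathrm{Con}(A_\theta,\delta)=\{\omega_\theta\in\Omega^1(A_\theta)^{\mathrm{co}H}:\overline{\mathrm{ver}}^X_\theta(\omega_\theta)=\mathbf 1\}$. Gauge transformations: $\mathfrak h=\mathrm{Der}_\epsilon(H)=\mathbb{C}X$ has the trivial left $H$-coaction, so $E_{A_\theta}(\mathfrak h)=A_\theta\,\square_H\mathfrak h=B\otimes\mathfrak h=E_A(\mathfrak h)$ and every element is $\zeta=b\otimes X$ for a unique $b\in B$; its $K$-coaction is $\zeta\mapsto b_{\underline{-1}}\otimes(b_{\underline 0}\otimes X)$. The contraction $\iota^\theta_\zeta$ is defined on $\Omega^1(A_\theta)$ by $\iota^\theta_\zeta(\lambda)=\overline{\mathrm{ver}}^X_\theta(\lambda)\star_\theta b$ (and is zero on $A_\theta$), and extended to $\Omega^\bullet(A_\theta)$ by $\iota^\theta_\zeta(\lambda\wedge_\theta\lambda')=\lambda\wedge_\theta\iota^\theta_\zeta(\lambda')+(-1)^mR_\theta(\zeta_{\underline{-1}}\otimes\lambda'_{\underline{-1}})\,\iota^\theta_{\zeta_{\underline 0}}(\lambda)\wedge_\theta\lambda'_{\underline 0}$ for $\lambda'$ of degree $m$. The action of $\zeta$ on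 $\lambda\in\Omega^\bullet(A_\theta)$ is $\lambda\,{}_\theta\!\triangleleft\zeta=\mathrm{d}_\theta\iota^\theta_\zeta(\lambda)+\iota^\theta_\zeta(\mathrm{d}_\theta\lambda)$. The undeformed action $\triangleleft$ on $\Omega^\bullet(A)$ is the case $\theta=0$. *)

theory Defs
  imports Complex_Main "HOL-Library.Poly_Mapping" "HOL-Library.Product_Plus"
    "HOL-Library.Set_Algebras"
begin

section \<open>Complex vector spaces and their tensor products\<close>

class complex_vector = ab_group_add +
  fixes scaleC :: "complex \<Rightarrow> 'a \<Rightarrow> 'a"  (infixr \<open>*\<^sub>C\<close> 75)
  assumes scaleC_add_right: "c *\<^sub>C (x + y) = c *\<^sub>C x + c *\<^sub>C y"
    and scaleC_add_left: "(c + c') *\<^sub>C x = c *\<^sub>C x + c' *\<^sub>C x"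
    and scaleC_scaleC: "c *\<^sub>C (c' *\<^sub>C x) = (c * c') *\<^sub>C x"
    and scaleC_one: "1 *\<^sub>C x = x"

global_interpretation cvec: vector_space "scaleC :: complex \<Rightarrow> 'a \<Rightarrow> 'a::complex_vector"
  defines cspan = cvec.span
    and csubspace = cvec.subspace
  by unfold_locales (simp_all add: scaleC_add_right scaleC_add_left scaleC_scaleC scaleC_one)

instantiation complex :: complex_vector
begin
definition scaleC_complex :: "complex \<Rightarrow> complex \<Rightarrow> complex" where "scaleC_complex = (*)"
instance by standard (simp_all add: scaleC_complex_def algebra_simps)
end

instantiation poly_mapping :: (type, complex_vector) complex_vector
begin
definition scaleC_poly_mapping :: "complex \<Rightarrow> ('a \<Rightarrow>\<^sub>0 'b) \<Rightarrow> ('a \<Rightarrow>\<^sub>0 'b)"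
  where "c *\<^sub>C p = Poly_Mapping.map (scaleC c) p"
lemma lookup_scaleC [simp]:
  "Poly_Mapping.lookup (c *\<^sub>C p) k = c *\<^sub>C Poly_Mapping.lookup (p :: 'a \<Rightarrow>\<^sub>0 'b) k"
  unfolding scaleC_poly_mapping_def by transfer (auto simp: when_def)
instance
  by standard (auto intro!: poly_mapping_eqI
      simp: lookup_add scaleC_add_right scaleC_add_left scaleC_scaleC scaleC_one)
end

text \<open>The space \<^typ>\<open>'a \<times> 'b \<Rightarrow>\<^sub>0 complex\<close> is the free vector space on pairs.\<close>

definition tensor_null :: "('a::complex_vector \<times> 'b::complex_vector \<Rightarrow>\<^sub>0 complex) set" where
  "tensor_null = cspan
     ({Poly_Mapping.single (x + x', y) 1 - Poly_Mapping.single (x, y) 1 - Poly_Mapping.single (x', y) 1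
         | x x' y. True}
    \<union> {Poly_Mapping.single (x, y + y') 1 - Poly_Mapping.single (x, y) 1 - Poly_Mapping.single (x, y') 1
         | x y y'. True}
    \<union> {Poly_Mapping.single (c *\<^sub>C x, y) 1 - c *\<^sub>C Poly_Mapping.single (x, y) 1 | c x y. True}
    \<union> {Poly_Mapping.single (x, c *\<^sub>C y) 1 - c *\<^sub>C Poly_Mapping.single (x, y) 1 | c x y. True})"

lemma csubspace_tensor_null: "csubspace tensor_null"
  unfolding tensor_null_def by (rule cvec.subspace_span)

quotient_type (overloaded) ('a, 'b) tensor =
    "('a::complex_vector \<times> 'b::complex_vector) \<Rightarrow>\<^sub>0 complex" / "\<lambda>p q. p - q \<in> tensor_null"
proof (rule equivpI)
  show "reflp (\<lambda>p q :: ('a \<times> 'b) \<Rightarrow>\<^sub>0 complex. p - q \<in> tensor_null)"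
    by (auto intro!: reflpI cvec.subspace_0[OF csubspace_tensor_null])
  show "symp (\<lambda>p q :: ('a \<times> 'b) \<Rightarrow>\<^sub>0 complex. p - q \<in> tensor_null)"
    by (auto intro!: sympI dest: cvec.subspace_neg[OF csubspace_tensor_null])
  show "transp (\<lambda>p q :: ('a \<times> 'b) \<Rightarrow>\<^sub>0 complex. p - q \<in> tensor_null)"
    by (rule transpI) (auto dest: cvec.subspace_add[OF csubspace_tensor_null])
qed

instantiation tensor :: (complex_vector, complex_vector) complex_vector
begin
lift_definition zero_tensor :: "('a, 'b) tensor" is 0 .
lift_definition plus_tensor :: "('a, 'b) tensor \<Rightarrow> ('a, 'b) tensor \<Rightarrow> ('a, 'b) tensor" is "(+)"
  subgoal for p p' q q'
    using cvec.subspace_add[OF csubspace_tensor_null, of "p - p'" "q - q'"] by (simp add: add_diff_add)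
  done
lift_definition uminus_tensor :: "('a, 'b) tensor \<Rightarrow> ('a, 'b) tensor" is uminus
  subgoal for p p'
    using cvec.subspace_neg[OF csubspace_tensor_null, of "p - p'"] by simp
  done
lift_definition minus_tensor :: "('a, 'b) tensor \<Rightarrow> ('a, 'b) tensor \<Rightarrow> ('a, 'b) tensor" is "(-)"
  subgoal for p p' q q'
    using cvec.subspace_diff[OF csubspace_tensor_null, of "p - p'" "q - q'"] by (simp add: algebra_simps)
  done
lift_definition scaleC_tensor :: "complex \<Rightarrow> ('a, 'b) tensor \<Rightarrow> ('a, 'b) tensor" is scaleC
  subgoal for c p p'
    using cvec.subspace_scale[OF csubspace_tensor_null, of "p - p'" c]
    by (simp add: cvec.scale_right_diff_distrib)
  done
instance
proof
  fix a b c :: "('a, 'b) tensor" and s s' :: complex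
  note [simp] = cvec.subspace_0[OF csubspace_tensor_null]
  show "a + b + c = a + (b + c)" by transfer (simp add: add.assoc)
  show "a + b = b + a" by transfer (simp add: add.commute)
  show "0 + a = a" by transfer simp
  show "- a + a = 0" by transfer simp
  show "a - b = a + - b" by transfer simp
  show "s *\<^sub>C (a + b) = s *\<^sub>C a + s *\<^sub>C b" by transfer (simp add: scaleC_add_right)
  show "(s + s') *\<^sub>C a = s *\<^sub>C a + s' *\<^sub>C a" by transfer (simp add: scaleC_add_left)
  show "s *\<^sub>C s' *\<^sub>C a = (s * s') *\<^sub>C a" by transfer (simp add: scaleC_scaleC)
  show "1 *\<^sub>C a = a" by transfer (simp add: scaleC_one)
qed
end

lift_definition tensor_of :: "'a::complex_vector \<Rightarrow> 'b::complex_vector \<Rightarrow> ('a, 'b) tensor"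
    (infixr \<open>\<otimes>\<close> 76)
  is "\<lambda>x y. Poly_Mapping.single (x, y) 1" .

definition free_lift :: "('k \<Rightarrow> 'v) \<Rightarrow> ('k \<Rightarrow>\<^sub>0 complex) \<Rightarrow> 'v::complex_vector" where
  "free_lift f p = (\<Sum>k\<in>Poly_Mapping.keys p. Poly_Mapping.lookup p k *\<^sub>C f k)"

text \<open>For bilinear \<open>f\<close>, \<open>tensor_lift f\<close> is the linear map with \<open>x \<otimes> y \<mapsto> f x y\<close>; the
  representative of the tensor that is used does not matter then.\<close>

definition tensor_lift ::
    "('a \<Rightarrow> 'b \<Rightarrow> 'v) \<Rightarrow> ('a::complex_vector, 'b::complex_vector) tensor \<Rightarrow> 'v::complex_vector" where
  "tensor_lift f t = free_lift (\<lambda>(x, y). f x y) (rep_tensor t)"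

definition cbilinear :: "('a::complex_vector \<Rightarrow> 'b::complex_vector \<Rightarrow> 'v::complex_vector) \<Rightarrow> bool" where
  "cbilinear f \<longleftrightarrow>
     (\<forall>y. Vector_Spaces.linear scaleC scaleC (\<lambda>x. f x y)) \<and> (\<forall>x. Vector_Spaces.linear scaleC scaleC (f x))"

lemma clinearI:
  assumes "\<And>x y. f (x + y) = f x + f y" "\<And>c x. f (c *\<^sub>C x) = c *\<^sub>C f x"
  shows "Vector_Spaces.linear scaleC scaleC (f :: 'a::complex_vector \<Rightarrow> 'b::complex_vector)"
  by (intro Vector_Spaces.linear.intro module_hom.intro module_hom_axioms.intro)
    (use assms in \<open>simp_all add: cvec.vector_space_axioms cvec.module_axioms\<close>)

lemma cbilinearI:
  assumes "\<And>x x' y. f (x + x') y = f x y + f x' y" "\<And>x y y'. f x (y + y') = f x y + f x y'"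
    "\<And>c x y. f (c *\<^sub>C x) y = c *\<^sub>C f x y" "\<And>c x y. f x (c *\<^sub>C y) = c *\<^sub>C f x y"
  shows "cbilinear f"
  unfolding cbilinear_def by (intro conjI allI clinearI assms)

lemma cbilinearD:
  assumes "cbilinear f"
  shows "f (x + x') y = f x y + f x' y" "f x (y + y') = f x y + f x y'"
    "f (c *\<^sub>C x) y = c *\<^sub>C f x y" "f x (c *\<^sub>C y) = c *\<^sub>C f x y"
proof -
  have "module_hom scaleC scaleC (\<lambda>x. f x y)" "module_hom scaleC scaleC (f x)" for x y
    using assms unfolding cbilinear_def Vector_Spaces.linear_def by auto
  from module_hom.add[OF this(1)] module_hom.add[OF this(2)]
    module_hom.scale[OF this(1)] module_hom.scale[OF this(2)]
  show "f (x + x') y = f x y + f x' y" "f x (y + y') = f x y + f x y'"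
    "f (c *\<^sub>C x) y = c *\<^sub>C f x y" "f x (c *\<^sub>C y) = c *\<^sub>C f x y" by auto
qed

lemma poly_mapping_sum_single:
  "(\<Sum>k\<in>Poly_Mapping.keys p. Poly_Mapping.single k (Poly_Mapping.lookup p k)) = p"
  by (rule poly_mapping_eqI)
    (auto simp: lookup_sum lookup_single when_def in_keys_iff sum.delta)

lemma poly_mapping_single_induct [case_names zero single add]:
  assumes "P 0" "\<And>k v. P (Poly_Mapping.single k v)" "\<And>p q. P p \<Longrightarrow> P q \<Longrightarrow> P (p + q)"
  shows "P (p :: 'a \<Rightarrow>\<^sub>0 'b::comm_monoid_add)"
proof -
  have "P (\<Sum>k\<in>K. Poly_Mapping.single k (Poly_Mapping.lookup p k))" if "finite K" for K
    using that by induction (auto intro: assms)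
  from this[OF finite_keys, of p] show ?thesis
    by (simp only: poly_mapping_sum_single)
qed

lemma free_lift_superset:
  assumes "finite M" "Poly_Mapping.keys p \<subseteq> M"
  shows "free_lift f p = (\<Sum>k\<in>M. Poly_Mapping.lookup p k *\<^sub>C f k)"
  unfolding free_lift_def
  by (rule sum.mono_neutral_left) (use assms in \<open>auto simp: in_keys_iff\<close>)

lemma free_lift_add: "free_lift f (p + q) = free_lift f p + free_lift f q"
proof -
  let ?M = "Poly_Mapping.keys p \<union> Poly_Mapping.keys q"
  have "free_lift f r = (\<Sum>k\<in>?M. Poly_Mapping.lookup r k *\<^sub>C f k)" if "r \<in> {p, q, p + q}" for r
    using that Poly_Mapping.keys_add[of p q] by (intro free_lift_superset) auto
  then show ?thesis
    by (simp add: lookup_add scaleC_add_left sum.distrib)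
qed

lemma free_lift_scaleC: "free_lift f (c *\<^sub>C p) = c *\<^sub>C free_lift f p"
proof -
  have "Poly_Mapping.keys (c *\<^sub>C p) \<subseteq> Poly_Mapping.keys p"
    by (auto simp: in_keys_iff scaleC_complex_def)
  then have "free_lift f (c *\<^sub>C p) = (\<Sum>k\<in>Poly_Mapping.keys p. Poly_Mapping.lookup (c *\<^sub>C p) k *\<^sub>C f k)"
    by (intro free_lift_superset) auto
  then show ?thesis
    by (simp add: free_lift_def cvec.scale_sum_right scaleC_scaleC scaleC_complex_def)
qed

lemma free_lift_single: "free_lift f (Poly_Mapping.single k c) = c *\<^sub>C f k"
  by (subst free_lift_superset[of "{k}"]) auto

lemma free_lift_diff: "free_lift f (p - q) = free_lift f p - free_lift f q"
  using free_lift_add[of f "p - q" q] by simp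

lemma free_lift_tensor_null:
  assumes f: "cbilinear f" and p: "p \<in> tensor_null"
  shows "free_lift (\<lambda>(x, y). f x y) p = 0"
proof -
  have "csubspace {p. free_lift (\<lambda>(x, y). f x y) p = 0}"
    by (rule cvec.subspaceI)
      (auto simp: free_lift_add free_lift_scaleC free_lift_def[of _ 0])
  then show ?thesis
    using p cbilinearD[OF f] unfolding tensor_null_def
    by (elim cvec.span_induct)
      (auto simp: free_lift_diff free_lift_single free_lift_scaleC scaleC_one)
qed

lemma tensor_lift_abs:
  assumes "cbilinear f"
  shows "tensor_lift f (abs_tensor p) = free_lift (\<lambda>(x, y). f x y) p"
proof -
  have "rep_tensor (abs_tensor p) - p \<in> tensor_null"
    using Quotient3_rep_abs[OF Quotient3_tensor]
    by (simp add: cvec.subspace_0[OF csubspace_tensor_null])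
  from free_lift_tensor_null[OF assms this] show ?thesis
    by (simp add: tensor_lift_def free_lift_diff)
qed

lemma tensor_lift_tensor_of:
  assumes "cbilinear f"
  shows "tensor_lift f (x \<otimes> y) = f x y"
  by (simp add: tensor_of.abs_eq tensor_lift_abs[OF assms] free_lift_single scaleC_one)

lemma clinearD:
  assumes "Vector_Spaces.linear scaleC scaleC (g :: 'a::complex_vector \<Rightarrow> 'b::complex_vector)"
  shows "g (x + y) = g x + g y" "g (c *\<^sub>C x) = c *\<^sub>C g x" "g 0 = 0"
    "g (sum f I) = (\<Sum>i\<in>I. g (f i))"
  using assms unfolding Vector_Spaces.linear_def
  by (auto simp: module_hom.add module_hom.scale module_hom.zero module_hom.sum)

lemma tensor_lift_comp_linear:
  assumes "Vector_Spaces.linear scaleC scaleC g"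
  shows "tensor_lift (\<lambda>x y. g (f x y)) t = g (tensor_lift f t)"
  by (simp add: tensor_lift_def free_lift_def clinearD[OF assms] case_prod_unfold)

lemma tensor_lift_diff_fun:
  "tensor_lift (\<lambda>x y. f x y - g x y) t = tensor_lift f t - tensor_lift g t"
  by (simp add: tensor_lift_def free_lift_def cvec.scale_right_diff_distrib sum_subtractf
      case_prod_unfold)

lemma tensor_of_add_left: "(x + x') \<otimes> y = x \<otimes> y + x' \<otimes> y"
proof (transfer, goal_cases)
  case (1 x x' y)
  have "Poly_Mapping.single (x + x', y) 1 - Poly_Mapping.single (x, y) 1 - Poly_Mapping.single (x', y) 1
      \<in> (tensor_null :: ('a \<times> 'b \<Rightarrow>\<^sub>0 complex) set)"
    unfolding tensor_null_def by (rule cvec.span_base) blast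
  then show ?case by (simp add: diff_diff_eq)
qed

lemma tensor_of_add_right: "x \<otimes> (y + y') = x \<otimes> y + x \<otimes> y'"
proof (transfer, goal_cases)
  case (1 x y y')
  have "Poly_Mapping.single (x, y + y') 1 - Poly_Mapping.single (x, y) 1 - Poly_Mapping.single (x, y') 1
      \<in> (tensor_null :: ('a \<times> 'b \<Rightarrow>\<^sub>0 complex) set)"
    unfolding tensor_null_def by (rule cvec.span_base) blast
  then show ?case by (simp add: diff_diff_eq)
qed

lemma tensor_of_scale_left: "(c *\<^sub>C x) \<otimes> y = c *\<^sub>C (x \<otimes> y)"
proof (transfer, goal_cases)
  case (1 c x y)
  show ?case unfolding tensor_null_def by (rule cvec.span_base) blast
qed

lemma tensor_of_scale_right: "x \<otimes> (c *\<^sub>C y) = c *\<^sub>C (x \<otimes> y)"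
proof (transfer, goal_cases)
  case (1 x c y)
  show ?case unfolding tensor_null_def by (rule cvec.span_base) blast
qed

lemmas tensor_of_simps =
  tensor_of_add_left tensor_of_add_right tensor_of_scale_left tensor_of_scale_right

lemma tensor_of_linear:
  "Vector_Spaces.linear scaleC scaleC (\<lambda>x. x \<otimes> y)" "Vector_Spaces.linear scaleC scaleC (\<lambda>y. x \<otimes> y)"
  by (rule clinearI; simp add: tensor_of_simps)+

lemma abs_tensor_free_lift: "abs_tensor p = free_lift (\<lambda>(x, y). x \<otimes> y) p"
proof -
  have abs: "abs_tensor (p + q) = abs_tensor p + abs_tensor q"
    "abs_tensor (c *\<^sub>C p) = c *\<^sub>C abs_tensor p" "abs_tensor 0 = 0"
    for p q :: "'a \<times> 'b \<Rightarrow>\<^sub>0 complex" and c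
    by (simp_all add: plus_tensor.abs_eq scaleC_tensor.abs_eq zero_tensor_def)
  have abs_sum: "abs_tensor (sum f I) = (\<Sum>i\<in>I. abs_tensor (f i))"
    for f :: "('a \<times> 'b) \<Rightarrow> ('a \<times> 'b \<Rightarrow>\<^sub>0 complex)" and I
    by (induction I rule: infinite_finite_induct) (simp_all add: abs)
  have single: "Poly_Mapping.single k c = c *\<^sub>C Poly_Mapping.single k 1" for k :: "'a \<times> 'b" and c
    by (rule poly_mapping_eqI) (simp add: lookup_single when_def scaleC_complex_def)
  have "p = (\<Sum>k\<in>Poly_Mapping.keys p. Poly_Mapping.lookup p k *\<^sub>C Poly_Mapping.single k 1)"
    by (simp add: poly_mapping_sum_single flip: single)
  then have "abs_tensor p =
      abs_tensor (\<Sum>k\<in>Poly_Mapping.keys p. Poly_Mapping.lookup p k *\<^sub>C Poly_Mapping.single k 1)"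
    by simp
  then show ?thesis
    by (simp add: abs_sum abs free_lift_def tensor_of.abs_eq case_prod_unfold)
qed

lemma tensor_lift_tensor_of_id: "tensor_lift (\<otimes>) t = t"
proof -
  have "free_lift (\<lambda>(x, y). x \<otimes> y) (rep_tensor t) = t"
    by (simp flip: abs_tensor_free_lift add: Quotient3_abs_rep[OF Quotient3_tensor])
  then show ?thesis by (simp add: tensor_lift_def)
qed

section \<open>The coordinate algebra of the three-sphere\<close>

datatype gen = Z1 | Z2 | Z1s | Z2s

lemma UNIV_gen: "UNIV = {Z1, Z2, Z1s, Z2s}"
  using gen.exhaust by auto

instance gen :: finite
  by standard (simp add: UNIV_gen)

fun gen_star :: "gen \<Rightarrow> gen" where
  "gen_star Z1 = Z1s"
| "gen_star Z2 = Z2s"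
| "gen_star Z1s = Z1"
| "gen_star Z2s = Z2"

text \<open>The free commutative \<open>*\<close>-algebra on \<open>z\<^sub>1, z\<^sub>2\<close> is the polynomial algebra in
  \<open>z\<^sub>1, z\<^sub>2, z\<^sub>1\<^sup>*, z\<^sub>2\<^sup>*\<close>.\<close>

type_synonym sphere_poly = "(gen \<Rightarrow>\<^sub>0 nat) \<Rightarrow>\<^sub>0 complex"

definition var :: "gen \<Rightarrow> sphere_poly" where
  "var g = Poly_Mapping.single (Poly_Mapping.single g 1) 1"

definition poly_subst :: "(complex \<Rightarrow> 'r) \<Rightarrow> (gen \<Rightarrow> 'r) \<Rightarrow> sphere_poly \<Rightarrow> 'r::comm_ring_1" where
  "poly_subst h x p = (\<Sum>m\<in>Poly_Mapping.keys p.
     h (Poly_Mapping.lookup p m) * (\<Prod>g\<in>UNIV. x g ^ Poly_Mapping.lookup m g))"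

definition poly_star :: "sphere_poly \<Rightarrow> sphere_poly" where
  "poly_star = poly_subst (\<lambda>c. Poly_Mapping.single 0 (cnj c)) (\<lambda>g. var (gen_star g))"

definition sphere_rel :: sphere_poly where
  "sphere_rel = var Z1s * var Z1 + var Z2s * var Z2 - 1"

inductive_set sphere_ideal :: "sphere_poly set" where
  rel: "sphere_rel \<in> sphere_ideal"
| add: "p \<in> sphere_ideal \<Longrightarrow> q \<in> sphere_ideal \<Longrightarrow> p + q \<in> sphere_ideal"
| mult: "p \<in> sphere_ideal \<Longrightarrow> q * p \<in> sphere_ideal"
| star: "p \<in> sphere_ideal \<Longrightarrow> poly_star p \<in> sphere_ideal"

locale coeff_hom =
  fixes h :: "complex \<Rightarrow> 'r::comm_ring_1"
  assumes hom_add: "h (c + c') = h c + h c'"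
    and hom_mult: "h (c * c') = h c * h c'"
    and hom_one: "h 1 = 1"
begin

lemma hom_zero: "h 0 = 0"
  using hom_add[of 0 0] by simp

lemma poly_subst_superset:
  assumes "finite M" "Poly_Mapping.keys p \<subseteq> M"
  shows "poly_subst h x p =
    (\<Sum>m\<in>M. h (Poly_Mapping.lookup p m) * (\<Prod>g\<in>UNIV. x g ^ Poly_Mapping.lookup m g))"
  unfolding poly_subst_def
  by (rule sum.mono_neutral_left) (use assms in \<open>auto simp: in_keys_iff hom_zero\<close>)

lemma poly_subst_add: "poly_subst h x (p + q) = poly_subst h x p + poly_subst h x q"
proof -
  let ?M = "Poly_Mapping.keys p \<union> Poly_Mapping.keys q"
  have "poly_subst h x r =
      (\<Sum>m\<in>?M. h (Poly_Mapping.lookup r m) * (\<Prod>g\<in>UNIV. x g ^ Poly_Mapping.lookup m g))"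
    if "r \<in> {p, q, p + q}" for r
    using that Poly_Mapping.keys_add[of p q] by (intro poly_subst_superset) auto
  then show ?thesis
    by (simp add: lookup_add hom_add distrib_right sum.distrib)
qed

lemma poly_subst_single:
  "poly_subst h x (Poly_Mapping.single m c) = h c * (\<Prod>g\<in>UNIV. x g ^ Poly_Mapping.lookup m g)"
  by (subst poly_subst_superset[of "{m}"]) auto

lemma poly_subst_zero: "poly_subst h x 0 = 0"
  by (simp add: poly_subst_def)

lemma poly_subst_mult: "poly_subst h x (p * q) = poly_subst h x p * poly_subst h x q"
proof (induction p rule: poly_mapping_single_induct)
  case (single k v)
  show ?case
    by (induction q rule: poly_mapping_single_induct)
      (simp_all add: poly_subst_zero poly_subst_single poly_subst_add mult_single hom_mult
        lookup_add power_add prod.distrib algebra_simps)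
qed (simp_all add: poly_subst_zero poly_subst_add distrib_right)

lemma poly_subst_one: "poly_subst h x 1 = 1"
  using poly_subst_single[of x 0 1] by (simp add: hom_one)

lemma poly_subst_diff: "poly_subst h x (p - q) = poly_subst h x p - poly_subst h x q"
  using poly_subst_add[of x "p - q" q] by simp

lemma poly_subst_var: "poly_subst h x (var g) = x g"
proof -
  have "(\<Prod>g'\<in>UNIV. x g' ^ (1 when g = g')) = (\<Prod>g'\<in>UNIV. if g' = g then x g' else 1)"
    by (rule prod.cong) (auto simp: when_def)
  then show ?thesis
    by (simp add: var_def poly_subst_single hom_one lookup_single)
qed

end

interpretation cnj_hom: coeff_hom "\<lambda>c. Poly_Mapping.single 0 (cnj c) :: sphere_poly"
  by standard (simp_all add: single_add mult_single)

lemma sphere_ideal_iff: "p \<in> sphere_ideal \<longleftrightarrow> (\<exists>q. p = q * sphere_rel)"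
proof
  assume "p \<in> sphere_ideal"
  then show "\<exists>q. p = q * sphere_rel"
  proof induction
    case rel
    show ?case by (rule exI[of _ 1]) simp
  next
    case (add p q)
    then show ?case by (metis distrib_right)
  next
    case (mult p q)
    then show ?case by (metis mult.assoc)
  next
    case (star p)
    from star.IH obtain q where q: "p = q * sphere_rel" by blast
    have "poly_star sphere_rel = sphere_rel"
      unfolding poly_star_def sphere_rel_def
      by (simp only: cnj_hom.poly_subst_diff cnj_hom.poly_subst_add cnj_hom.poly_subst_mult
          cnj_hom.poly_subst_var cnj_hom.poly_subst_one gen_star.simps mult.commute)
    then have "poly_star p = poly_star q * sphere_rel"
      by (simp add: q poly_star_def cnj_hom.poly_subst_mult)
    then show ?case ..
  qed
qed (auto intro: sphere_ideal.intros)

lemma sphere_ideal_diff: "p \<in> sphere_ideal \<Longrightarrow> q \<in> sphere_ideal \<Longrightarrow> p - q \<in> sphere_ideal"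
  unfolding sphere_ideal_iff by (metis left_diff_distrib)

lemma sphere_ideal_zero: "0 \<in> sphere_ideal"
  unfolding sphere_ideal_iff by (rule exI[of _ 0]) simp

lemma sphere_ideal_uminus: "p \<in> sphere_ideal \<Longrightarrow> - p \<in> sphere_ideal"
  using sphere_ideal_diff[OF sphere_ideal_zero] by fastforce

lemma sphere_ideal_mult_right: "p \<in> sphere_ideal \<Longrightarrow> p * q \<in> sphere_ideal"
  by (subst mult.commute) (rule sphere_ideal.mult)

quotient_type sphere = sphere_poly / "\<lambda>p q. p - q \<in> sphere_ideal"
proof (rule equivpI)
  show "reflp (\<lambda>p q. p - q \<in> sphere_ideal)"
    by (auto intro!: reflpI sphere_ideal_zero)
  show "symp (\<lambda>p q. p - q \<in> sphere_ideal)"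
    by (auto intro!: sympI dest: sphere_ideal_uminus)
  show "transp (\<lambda>p q. p - q \<in> sphere_ideal)"
    by (rule transpI) (auto dest: sphere_ideal.add)
qed

lemma one_notin_sphere_ideal: "1 \<notin> sphere_ideal"
proof
  assume "1 \<in> sphere_ideal"
  then obtain q :: sphere_poly where q: "1 = q * sphere_rel"
    unfolding sphere_ideal_iff by blast
  interpret coeff_hom "\<lambda>c::complex. c"
    by standard simp_all
  define x :: "gen \<Rightarrow> complex" where "x g = (if g = Z1 \<or> g = Z1s then 1 else 0)" for g
  have "poly_subst (\<lambda>c. c) x sphere_rel = 0"
    by (simp add: sphere_rel_def poly_subst_diff poly_subst_add poly_subst_mult poly_subst_var
        poly_subst_one x_def)
  then show False
    using arg_cong[OF q, of "poly_subst (\<lambda>c. c) x"] by (simp add: poly_subst_mult poly_subst_one)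
qed

instantiation sphere :: comm_ring_1
begin
lift_definition zero_sphere :: sphere is 0 .
lift_definition one_sphere :: sphere is 1 .
lift_definition plus_sphere :: "sphere \<Rightarrow> sphere \<Rightarrow> sphere" is "(+)"
  subgoal for p p' q q'
    using sphere_ideal.add[of "p - p'" "q - q'"] by (simp add: add_diff_add)
  done
lift_definition uminus_sphere :: "sphere \<Rightarrow> sphere" is uminus
  subgoal for p p'
    using sphere_ideal_uminus[of "p - p'"] by simp
  done
lift_definition minus_sphere :: "sphere \<Rightarrow> sphere \<Rightarrow> sphere" is "(-)"
  subgoal for p p' q q'
    using sphere_ideal_diff[of "p - p'" "q - q'"] by (simp add: algebra_simps)
  done
lift_definition times_sphere :: "sphere \<Rightarrow> sphere \<Rightarrow> sphere" is "(*)"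
  subgoal for p p' q q'
    using sphere_ideal.add[OF sphere_ideal_mult_right[of "p - p'" q] sphere_ideal.mult[of "q - q'" p']]
    by (simp add: algebra_simps)
  done
instance
proof
  fix a b c :: sphere
  note [simp] = sphere_ideal_zero
  show "a + b + c = a + (b + c)" by transfer (simp add: add.assoc)
  show "a + b = b + a" by transfer (simp add: add.commute)
  show "0 + a = a" by transfer simp
  show "- a + a = 0" by transfer simp
  show "a - b = a + - b" by transfer simp
  show "a * b * c = a * (b * c)" by transfer (simp add: mult.assoc)
  show "a * b = b * a" by transfer (simp add: mult.commute)
  show "1 * a = a" by transfer simp
  show "(a + b) * c = a * c + b * c" by transfer (simp add: distrib_right)
  show "(0::sphere) \<noteq> 1"
    by transfer (use sphere_ideal_uminus one_notin_sphere_ideal in fastforce)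
qed
end

lemma scaleC_sphere_poly: "c *\<^sub>C p = Poly_Mapping.single 0 c * (p :: sphere_poly)"
  by (simp add: scaleC_poly_mapping_def scaleC_complex_def mult_map_scale_conv_mult)

instantiation sphere :: complex_vector
begin
lift_definition scaleC_sphere :: "complex \<Rightarrow> sphere \<Rightarrow> sphere" is scaleC
  subgoal for c p p'
    using sphere_ideal.mult[of "p - p'" "Poly_Mapping.single 0 c"]
    by (simp add: scaleC_sphere_poly right_diff_distrib)
  done
instance
proof
  fix a b :: sphere and c c' :: complex
  note [simp] = sphere_ideal_zero
  show "c *\<^sub>C (a + b) = c *\<^sub>C a + c *\<^sub>C b" by transfer (simp add: scaleC_add_right)
  show "(c + c') *\<^sub>C a = c *\<^sub>C a + c' *\<^sub>C a" by transfer (simp add: scaleC_add_left)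
  show "c *\<^sub>C c' *\<^sub>C a = (c * c') *\<^sub>C a" by transfer (simp add: scaleC_scaleC)
  show "1 *\<^sub>C a = a" by transfer simp
qed
end

lemma scaleC_sphere_mult: "c *\<^sub>C a * b = c *\<^sub>C (a * b)" for a b :: sphere
  by transfer (simp add: scaleC_sphere_poly mult.assoc sphere_ideal_zero)

lift_definition zgen :: "gen \<Rightarrow> sphere" is var .


section \<open>The coactions\<close>

text \<open>Since \<open>{t\<^sub>m}\<close> is a basis of \<open>K = O(T\<^sup>2)\<close> and \<open>{t\<^sup>n}\<close> one of \<open>H = O(U(1))\<close>, elements of
  \<open>K \<otimes> V\<close> and \<open>V \<otimes> H\<close> are written as finitely supported functions \<^typ>\<open>int \<times> int \<Rightarrow>\<^sub>0 'v\<close> and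
  \<^typ>\<open>int \<Rightarrow>\<^sub>0 'v\<close>, where \<open>t\<^sub>m \<otimes> v\<close>, respectively \<open>v \<otimes> t\<^sup>n\<close>, is \<open>Poly_Mapping.single m v\<close>. For
  \<open>V = A\<close> the convolution product of \<^typ>\<open>int \<times> int \<Rightarrow>\<^sub>0 sphere\<close> is the product of the tensor
  product algebra, as \<open>t\<^sub>m t\<^sub>m\<^sub>' = t\<^sub>m\<^sub>+\<^sub>m\<^sub>'\<close>, and likewise for \<open>H\<close>.\<close>

fun K_weight :: "gen \<Rightarrow> int \<times> int" where
  "K_weight Z1 = (1, 0)"
| "K_weight Z2 = (0, 1)"
| "K_weight Z1s = (-1, 0)"
| "K_weight Z2s = (0, -1)"

fun H_weight :: "gen \<Rightarrow> int" where
  "H_weight Z1 = 1"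
| "H_weight Z2 = 1"
| "H_weight Z1s = -1"
| "H_weight Z2s = -1"

lemma coeff_hom_single:
  "coeff_hom (\<lambda>c. Poly_Mapping.single (0::'m::comm_monoid_add) (c *\<^sub>C (1::sphere)))"
proof
  fix c c' :: complex
  have "(c * c') *\<^sub>C (1::sphere) = (c *\<^sub>C 1) * (c' *\<^sub>C 1)"
    by (simp add: scaleC_sphere_mult scaleC_scaleC)
  then show "Poly_Mapping.single (0::'m) ((c * c') *\<^sub>C (1::sphere)) =
      Poly_Mapping.single 0 (c *\<^sub>C 1) * Poly_Mapping.single 0 (c' *\<^sub>C 1)"
    by (simp add: mult_single)
qed (simp_all add: scaleC_add_left single_add)

lemma sphere_relation: "zgen Z1s * zgen Z1 + zgen Z2s * zgen Z2 = 1"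
  by transfer (use sphere_ideal.rel in \<open>simp add: sphere_rel_def\<close>)

lemma poly_subst_weight_cong:
  fixes w :: "gen \<Rightarrow> 'm::comm_monoid_add"
  defines "F \<equiv> poly_subst (\<lambda>c. Poly_Mapping.single 0 (c *\<^sub>C (1::sphere))) (\<lambda>g. Poly_Mapping.single (w g) (zgen g))"
  assumes w: "w Z1s + w Z1 = 0" "w Z2s + w Z2 = 0" and pq: "p - q \<in> sphere_ideal"
  shows "F p = F q"
proof -
  interpret coeff_hom "\<lambda>c. Poly_Mapping.single (0::'m) (c *\<^sub>C (1::sphere))"
    by (rule coeff_hom_single)
  obtain r where r: "p - q = r * sphere_rel"
    using pq sphere_ideal_iff by blast
  have "F sphere_rel = Poly_Mapping.single 0 (zgen Z1s * zgen Z1 + zgen Z2s * zgen Z2) - 1"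
    by (simp add: F_def sphere_rel_def poly_subst_diff poly_subst_add poly_subst_mult
        poly_subst_var poly_subst_one mult_single w single_add)
  then have "F (p - q) = 0"
    by (simp add: r F_def poly_subst_mult sphere_relation)
  then show ?thesis
    by (simp add: F_def poly_subst_diff)
qed

lift_definition coact_K :: "sphere \<Rightarrow> (int \<times> int \<Rightarrow>\<^sub>0 sphere)" is
  "poly_subst (\<lambda>c. Poly_Mapping.single 0 (c *\<^sub>C 1)) (\<lambda>g. Poly_Mapping.single (K_weight g) (zgen g))"
  by (rule poly_subst_weight_cong) (simp_all add: zero_prod_def)

lift_definition coact_H :: "sphere \<Rightarrow> (int \<Rightarrow>\<^sub>0 sphere)" is
  "poly_subst (\<lambda>c. Poly_Mapping.single 0 (c *\<^sub>C 1)) (\<lambda>g. Poly_Mapping.single (H_weight g) (zgen g))"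
  by (rule poly_subst_weight_cong) simp_all


text \<open>With \<open>p = a\<^sub>-\<^sub>1 \<otimes> a\<^sub>0\<close>, \<open>weight_sum p f\<close> is \<open>f (a\<^sub>-\<^sub>1, a\<^sub>0)\<close> in Sweedler notation, for \<open>f\<close>
  additive in its second argument.\<close>

definition weight_sum :: "('m \<Rightarrow>\<^sub>0 'v::zero) \<Rightarrow> ('m \<Rightarrow> 'v \<Rightarrow> 'w) \<Rightarrow> 'w::comm_monoid_add" where
  "weight_sum p f = (\<Sum>m\<in>Poly_Mapping.keys p. f m (Poly_Mapping.lookup p m))"

lemma weight_sum_superset:
  assumes "finite M" "Poly_Mapping.keys p \<subseteq> M" "\<And>m. f m 0 = 0"
  shows "weight_sum p f = (\<Sum>m\<in>M. f m (Poly_Mapping.lookup p m))"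
  unfolding weight_sum_def
  by (rule sum.mono_neutral_left) (use assms in \<open>auto simp: in_keys_iff\<close>)

lemma weight_sum_add:
  assumes "\<And>m x y. f m (x + y) = f m x + f m y" "\<And>m. f m 0 = 0"
  shows "weight_sum (p + q) f = weight_sum p f + weight_sum q f"
proof -
  let ?M = "Poly_Mapping.keys p \<union> Poly_Mapping.keys q"
  have "weight_sum r f = (\<Sum>m\<in>?M. f m (Poly_Mapping.lookup r m))" if "r \<in> {p, q, p + q}" for r
    using that Poly_Mapping.keys_add[of p q] assms(2) by (intro weight_sum_superset) auto
  then show ?thesis
    by (simp add: lookup_add assms sum.distrib)
qed

lemma weight_sum_scale:
  assumes "\<And>m c x. f m (c *\<^sub>C x) = c *\<^sub>C f m x"
  shows "weight_sum (c *\<^sub>C p) f = c *\<^sub>C weight_sum p (f :: _ \<Rightarrow> 'v::complex_vector \<Rightarrow> 'w::complex_vector)"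
proof -
  have 0: "f m 0 = 0" for m
    using assms[of m 0 0] by simp
  have "Poly_Mapping.keys (c *\<^sub>C p) \<subseteq> Poly_Mapping.keys p"
    by (auto simp: in_keys_iff)
  then have "weight_sum (c *\<^sub>C p) f =
      (\<Sum>m\<in>Poly_Mapping.keys p. f m (Poly_Mapping.lookup (c *\<^sub>C p) m))"
    by (intro weight_sum_superset) (auto simp: 0)
  then show ?thesis
    by (simp add: assms weight_sum_def cvec.scale_sum_right)
qed

lemma weight_sum_single:
  assumes "\<And>m. f m 0 = 0"
  shows "weight_sum (Poly_Mapping.single m x) f = f m x"
  by (subst weight_sum_superset[of "{m}"]) (auto simp: assms)

lemma coact_K_add: "coact_K (a + b) = coact_K a + coact_K b"
  by transfer (rule coeff_hom.poly_subst_add[OF coeff_hom_single])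

lemma coact_K_scale: "coact_K (c *\<^sub>C a) = c *\<^sub>C coact_K a"
proof (transfer, goal_cases)
  case (1 c p)
  have "Poly_Mapping.single 0 (c *\<^sub>C (1::sphere)) * q = c *\<^sub>C q" for q :: "int \<times> int \<Rightarrow>\<^sub>0 sphere"
    by (induction q rule: poly_mapping_single_induct)
      (auto intro!: poly_mapping_eqI simp: mult_single scaleC_sphere_mult lookup_single when_def
        distrib_left scaleC_add_right)
  then show ?case
    by (simp add: scaleC_sphere_poly coeff_hom.poly_subst_mult[OF coeff_hom_single]
        coeff_hom.poly_subst_single[OF coeff_hom_single])
qed

lemma coact_K_one: "coact_K 1 = Poly_Mapping.single 0 1"
  by transfer (simp add: coeff_hom.poly_subst_one[OF coeff_hom_single])

lemma coeff_hom_scale_one: "coeff_hom (\<lambda>c. c *\<^sub>C (1::sphere))"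
  by standard (simp_all add: scaleC_add_left scaleC_sphere_mult scaleC_scaleC)

lemma poly_subst_zgen: "poly_subst (\<lambda>c. c *\<^sub>C 1) zgen p = abs_sphere p"
proof (induction p rule: poly_mapping_single_induct)
  case zero
  show ?case
    by (simp add: coeff_hom.poly_subst_zero[OF coeff_hom_scale_one] zero_sphere.abs_eq[symmetric])
next
  case (single k c)
  have pow: "var g ^ n = Poly_Mapping.single (Poly_Mapping.single g n) 1" for g n
    by (induction n) (simp_all add: var_def mult_single flip: single_add)
  have prod: "(\<Prod>g\<in>G. var g ^ Poly_Mapping.lookup k g) =
      Poly_Mapping.single (\<Sum>g\<in>G. Poly_Mapping.single g (Poly_Mapping.lookup k g)) 1"
    if "finite G" for G
    using that by induction (simp_all add: pow mult_single)
  have "(\<Sum>g\<in>UNIV. Poly_Mapping.single g (Poly_Mapping.lookup k g)) = k"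
    by (rule poly_mapping_eqI) (simp add: lookup_sum lookup_single when_def)
  then have k: "(\<Prod>g\<in>UNIV. var g ^ Poly_Mapping.lookup k g) = Poly_Mapping.single k 1"
    by (simp add: prod)
  note abs = one_sphere_def[symmetric] times_sphere.abs_eq[symmetric] zgen.abs_eq
  have abs_pow: "abs_sphere (var g ^ n) = zgen g ^ n" for g n
    by (induction n) (simp_all add: abs)
  have abs_prod: "abs_sphere (\<Prod>g\<in>G. var g ^ Poly_Mapping.lookup k g) =
      (\<Prod>g\<in>G. zgen g ^ Poly_Mapping.lookup k g)" if "finite G" for G
    using that by induction (simp_all add: abs abs_pow)
  have "Poly_Mapping.single k c = c *\<^sub>C (\<Prod>g\<in>UNIV. var g ^ Poly_Mapping.lookup k g)"
    unfolding k by (simp add: scaleC_sphere_poly mult_single)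
  then have "abs_sphere (Poly_Mapping.single k c) = c *\<^sub>C (\<Prod>g\<in>UNIV. zgen g ^ Poly_Mapping.lookup k g)"
    by (simp add: abs_prod flip: scaleC_sphere.abs_eq)
  then show ?case
    by (simp add: coeff_hom.poly_subst_single[OF coeff_hom_scale_one] scaleC_sphere_mult)
next
  case (add p q)
  then show ?case
    by (simp add: coeff_hom.poly_subst_add[OF coeff_hom_scale_one] plus_sphere.abs_eq)
qed

lemma coact_K_counit: "weight_sum (coact_K a) (\<lambda>m x. x) = a"
proof -
  define E where "E p = weight_sum p (\<lambda>(m :: int \<times> int) (x :: sphere). x)" for p
  have E_single: "E (Poly_Mapping.single m x) = x" for m x
    unfolding E_def by (rule weight_sum_single) simp
  have E_add: "E (p + q) = E p + E q" for p q
    unfolding E_def by (rule weight_sum_add) simp_all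
  have E_zero: "E 0 = 0"
    by (simp add: E_def weight_sum_def)
  have E_mult: "E (p * q) = E p * E q" for p q
  proof (induction p rule: poly_mapping_single_induct)
    case (single k v)
    show ?case
      by (induction q rule: poly_mapping_single_induct)
        (simp_all add: E_single E_add E_zero mult_single distrib_left)
  qed (simp_all add: E_zero E_add distrib_right)
  have E_one: "E 1 = 1"
    using E_single[of 0 1] by simp
  have E_pow: "E (p ^ n) = E p ^ n" for p n
    by (induction n) (simp_all add: E_one E_mult)
  have E_prod: "E (prod f G) = (\<Prod>g\<in>G. E (f g))" for f and G :: "gen set"
    by (induction G rule: infinite_finite_induct) (simp_all add: E_one E_mult)
  have E_sum: "E (sum f G) = (\<Sum>g\<in>G. E (f g))" for f and G :: "(gen \<Rightarrow>\<^sub>0 nat) set"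
    by (induction G rule: infinite_finite_induct) (simp_all add: E_zero E_add)
  obtain p where p: "a = abs_sphere p"
    by (metis Quotient3_abs_rep[OF Quotient3_sphere])
  have "E (coact_K a) = poly_subst (\<lambda>c. c *\<^sub>C 1) zgen p"
    by (simp add: p coact_K.abs_eq poly_subst_def E_sum E_mult E_prod E_pow E_single)
  then show ?thesis
    by (simp add: poly_subst_zgen p E_def)
qed

text \<open>The coinvariants \<open>B\<close>.\<close>

definition base :: "sphere set" where
  "base = {b. coact_H b = Poly_Mapping.single 0 b}"

type_synonym sphere2 = "(sphere, sphere) tensor"

definition coact_K2 :: "sphere2 \<Rightarrow> (int \<times> int \<Rightarrow>\<^sub>0 sphere2)" where
  "coact_K2 = tensor_lift (\<lambda>a a'. weight_sum (coact_K a) (\<lambda>m x.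
     weight_sum (coact_K a') (\<lambda>n y. Poly_Mapping.single (m + n) (x \<otimes> y))))"

definition coact_H2 :: "sphere2 \<Rightarrow> (int \<Rightarrow>\<^sub>0 sphere2)" where
  "coact_H2 = tensor_lift (\<lambda>a a'. weight_sum (coact_H a) (\<lambda>m x.
     weight_sum (coact_H a') (\<lambda>n y. Poly_Mapping.single (m + n) (x \<otimes> y))))"


section \<open>The deformed algebra\<close>

text \<open>The values of \<open>\<sigma>\<^sub>\<theta>\<close> and \<open>R\<^sub>\<theta>\<close> on the basis \<open>t\<^sub>m \<otimes> t\<^sub>m\<^sub>'\<close> of \<open>K \<otimes> K\<close>.\<close>

fun sigma :: "real \<Rightarrow> int \<times> int \<Rightarrow> int \<times> int \<Rightarrow> complex" where
  "sigma \<theta> (m1, m2) (n1, n2) =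
     exp (of_real pi * \<i> * of_real \<theta> * of_int (m1 * n2 - m2 * n1))"

fun Rmat :: "real \<Rightarrow> int \<times> int \<Rightarrow> int \<times> int \<Rightarrow> complex" where
  "Rmat \<theta> (m1, m2) (n1, n2) =
     exp (- 2 * of_real pi * \<i> * of_real \<theta> * of_int (m1 * n2 - m2 * n1))"

lemma Rmat_sigma: "Rmat \<theta> m n = inverse ((sigma \<theta> m n)\<^sup>2)"
  by (cases m; cases n) (simp add: exp_minus[symmetric] exp_double[symmetric] mult.assoc)

definition star :: "real \<Rightarrow> sphere \<Rightarrow> sphere \<Rightarrow> sphere" where
  "star \<theta> a a' = weight_sum (coact_K a) (\<lambda>m x. weight_sum (coact_K a') (\<lambda>n y.
     sigma \<theta> m n *\<^sub>C (x * y)))"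

definition mu :: "real \<Rightarrow> sphere2 \<Rightarrow> sphere" where
  "mu \<theta> = tensor_lift (star \<theta>)"

definition ker_mu :: "real \<Rightarrow> sphere2 set" where
  "ker_mu \<theta> = {t. mu \<theta> t = 0}"

text \<open>The product of the braided tensor algebra \<open>A\<^sub>\<theta> \<otimes> A\<^sub>\<theta>\<close>.\<close>

definition braided_mult :: "real \<Rightarrow> sphere2 \<Rightarrow> sphere2 \<Rightarrow> sphere2" where
  "braided_mult \<theta> s t = tensor_lift (\<lambda>a a'. tensor_lift (\<lambda>b b'.
     weight_sum (coact_K b) (\<lambda>m x. weight_sum (coact_K a') (\<lambda>n y.
       Rmat \<theta> m n *\<^sub>C (star \<theta> a x \<otimes> star \<theta> y b')))) t) s"

definition ker_mu_sq :: "real \<Rightarrow> sphere2 set" where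
  "ker_mu_sq \<theta> = cspan {braided_mult \<theta> s t | s t. s \<in> ker_mu \<theta> \<and> t \<in> ker_mu \<theta>}"


lemma star_bilinear: "cbilinear (star \<theta>)"
proof (rule cbilinearI)
  fix a a' b b' :: sphere and c :: complex
  note [simp] = distrib_left distrib_right scaleC_add_right
  have scale_right: "x * c *\<^sub>C y = c *\<^sub>C (x * y)" for x y :: sphere and c
    by (metis mult.commute scaleC_sphere_mult)
  have swap: "c *\<^sub>C d *\<^sub>C x = d *\<^sub>C c *\<^sub>C x" for c d and x :: sphere
    by (simp add: scaleC_scaleC mult.commute)
  have in_add: "weight_sum (coact_K a') (\<lambda>n y. sigma \<theta> m n *\<^sub>C ((x + x') * y)) =
      weight_sum (coact_K a') (\<lambda>n y. sigma \<theta> m n *\<^sub>C (x * y)) +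
      weight_sum (coact_K a') (\<lambda>n y. sigma \<theta> m n *\<^sub>C (x' * y))" for m x x'
    by (simp add: weight_sum_def sum.distrib)
  have in_scale: "weight_sum (coact_K a') (\<lambda>n y. sigma \<theta> m n *\<^sub>C (c *\<^sub>C x * y)) =
      c *\<^sub>C weight_sum (coact_K a') (\<lambda>n y. sigma \<theta> m n *\<^sub>C (x * y))" for m x c
    by (simp add: weight_sum_def cvec.scale_sum_right scaleC_sphere_mult scaleC_scaleC mult.commute)
  show "star \<theta> (a + b) a' = star \<theta> a a' + star \<theta> b a'"
    unfolding star_def coact_K_add
    by (rule weight_sum_add) (rule in_add, simp add: weight_sum_def)
  show "star \<theta> (c *\<^sub>C a) a' = c *\<^sub>C star \<theta> a a'"
    unfolding star_def coact_K_scale by (rule weight_sum_scale) (rule in_scale)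
  have "weight_sum (coact_K (a' + b')) (\<lambda>n y. sigma \<theta> m n *\<^sub>C (x * y)) =
      weight_sum (coact_K a') (\<lambda>n y. sigma \<theta> m n *\<^sub>C (x * y)) +
      weight_sum (coact_K b') (\<lambda>n y. sigma \<theta> m n *\<^sub>C (x * y))" for m x
    unfolding coact_K_add by (rule weight_sum_add) simp_all
  then show "star \<theta> a (a' + b') = star \<theta> a a' + star \<theta> a b'"
    unfolding star_def by (simp add: weight_sum_def[of "coact_K a"] sum.distrib)
  have "weight_sum (coact_K (c *\<^sub>C a')) (\<lambda>n y. sigma \<theta> m n *\<^sub>C (x * y)) =
      c *\<^sub>C weight_sum (coact_K a') (\<lambda>n y. sigma \<theta> m n *\<^sub>C (x * y))" for m x
    unfolding coact_K_scale by (rule weight_sum_scale) (simp add: scale_right swap[of c])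
  then show "star \<theta> a (c *\<^sub>C a') = c *\<^sub>C star \<theta> a a'"
    unfolding star_def by (simp add: weight_sum_def[of "coact_K a"] cvec.scale_sum_right)
qed

lemma star_one_right: "star \<theta> a 1 = a"
proof -
  have "sigma \<theta> m 0 = 1" for m
    by (cases m) (simp add: zero_prod_def)
  then have "star \<theta> a 1 = weight_sum (coact_K a) (\<lambda>m x. x)"
    by (simp add: star_def coact_K_one weight_sum_single del: single_one)
  then show ?thesis by (simp add: coact_K_counit)
qed

lemma star_zero: "star 0 a a' = a * a'"
proof -
  have [simp]: "sigma 0 m n = 1" for m n
    by (cases m; cases n) simp
  have "star 0 a a' = weight_sum (coact_K a) (\<lambda>m x. x) * weight_sum (coact_K a') (\<lambda>m x. x)"
    by (simp add: star_def weight_sum_def sum_product)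
  then show ?thesis by (simp add: coact_K_counit)
qed

lemma braided_mult_zero: "braided_mult 0 (a \<otimes> a') (b \<otimes> b') = (a * b) \<otimes> (a' * b')"
proof -
  have [simp]: "Rmat 0 m n = 1" for m n
    by (cases m; cases n) simp
  have mult_scale: "x * c *\<^sub>C y = c *\<^sub>C (x * y)" for x y :: sphere and c
    by (metis mult.commute scaleC_sphere_mult)
  have inner: "weight_sum (coact_K b) (\<lambda>m x. weight_sum (coact_K a') (\<lambda>n y.
      Rmat 0 m n *\<^sub>C (star 0 a x \<otimes> star 0 y b'))) = (a * b) \<otimes> (a' * b')" for a a' b b'
  proof -
    have "(a * weight_sum (coact_K b) (\<lambda>m x. x)) \<otimes> (weight_sum (coact_K a') (\<lambda>m x. x) * b') =
      weight_sum (coact_K b) (\<lambda>m x. weight_sum (coact_K a') (\<lambda>n y. (a * x) \<otimes> (y * b')))"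
      by (simp add: weight_sum_def sum_distrib_left sum_distrib_right
          clinearD(4)[OF tensor_of_linear(1)] clinearD(4)[OF tensor_of_linear(2)])
        (rule sum.swap)
    then show ?thesis by (simp add: star_zero coact_K_counit)
  qed
  have bil: "cbilinear (\<lambda>b b'. (a * b) \<otimes> (a' * b'))" for a a' :: sphere
    by (rule cbilinearI)
      (simp_all add: distrib_left tensor_of_simps mult_scale)
  have bil': "cbilinear (\<lambda>a a'. (a * b) \<otimes> (a' * b'))"
    by (rule cbilinearI)
      (simp_all add: distrib_right tensor_of_simps scaleC_sphere_mult)
  show ?thesis
    unfolding braided_mult_def inner
    by (simp only: tensor_lift_tensor_of[OF bil] tensor_lift_tensor_of[OF bil'])
qed

section \<open>One-forms\<close>

text \<open>Elements of a quotient \<open>V / N\<close> are the cosets \<open>v +o N\<close>; the zero element is \<open>N\<close> and the sum of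
  two cosets is their elementwise sum \<open>+\<close>. The algebra \<open>A\<close> is \<open>A\<^sub>0\<close> (see \<open>star_zero\<close> and
  \<open>braided_mult_zero\<close> below), so \<open>\<Omega>\<^sup>1(A)\<close> is \<open>Omega1 0\<close>.\<close>

definition Omega1 :: "real \<Rightarrow> sphere2 set set" where
  "Omega1 \<theta> = {t +o ker_mu_sq \<theta> | t. t \<in> ker_mu \<theta>}"

definition rep :: "'v set \<Rightarrow> 'v" where
  "rep C = (SOME v. v \<in> C)"

definition delta2 :: "sphere \<Rightarrow> sphere2" where
  "delta2 a = 1 \<otimes> a - a \<otimes> 1"

definition d0 :: "real \<Rightarrow> sphere \<Rightarrow> sphere2 set" where
  "d0 \<theta> a = delta2 a +o ker_mu_sq \<theta>"

definition lmult :: "real \<Rightarrow> sphere \<Rightarrow> sphere2 \<Rightarrow> sphere2" where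
  "lmult \<theta> a = tensor_lift (\<lambda>x y. star \<theta> a x \<otimes> y)"

definition rmult :: "real \<Rightarrow> sphere2 \<Rightarrow> sphere \<Rightarrow> sphere2" where
  "rmult \<theta> t a = tensor_lift (\<lambda>x y. x \<otimes> star \<theta> y a) t"

definition lact :: "real \<Rightarrow> sphere \<Rightarrow> sphere2 set \<Rightarrow> sphere2 set" where
  "lact \<theta> a \<eta> = lmult \<theta> a (rep \<eta>) +o ker_mu_sq \<theta>"

definition ract :: "real \<Rightarrow> sphere2 set \<Rightarrow> sphere \<Rightarrow> sphere2 set" where
  "ract \<theta> \<eta> a = rmult \<theta> (rep \<eta>) a +o ker_mu_sq \<theta>"

lemma ker_mu_expansion:
  assumes "t \<in> ker_mu \<theta>"
  shows "tensor_lift (\<lambda>a a'. lmult \<theta> a (delta2 a')) t = t"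
proof -
  have bil: "cbilinear (\<lambda>x y. star \<theta> a x \<otimes> y)" for a
    by (rule cbilinearI) (simp_all add: cbilinearD[OF star_bilinear] tensor_of_simps)
  have diff: "tensor_lift f (s - t) = tensor_lift f s - tensor_lift f t"
    if "cbilinear f" for f :: "sphere \<Rightarrow> sphere \<Rightarrow> sphere2" and s t
  proof -
    obtain p q where "s = abs_tensor p" "t = abs_tensor q"
      by (metis Quotient3_abs_rep[OF Quotient3_tensor])
    then show ?thesis
      by (simp add: minus_tensor.abs_eq tensor_lift_abs[OF that] free_lift_diff)
  qed
  have "lmult \<theta> a (delta2 a') = a \<otimes> a' - star \<theta> a a' \<otimes> 1" for a a'
    by (simp add: lmult_def delta2_def diff[OF bil] tensor_lift_tensor_of[OF bil] star_one_right)
  then have "tensor_lift (\<lambda>a a'. lmult \<theta> a (delta2 a')) t =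
      tensor_lift (\<otimes>) t - tensor_lift (\<lambda>a a'. star \<theta> a a' \<otimes> 1) t"
    by (simp add: tensor_lift_diff_fun)
  also have "tensor_lift (\<lambda>a a'. star \<theta> a a' \<otimes> 1) t = mu \<theta> t \<otimes> (1::sphere)"
    unfolding mu_def by (rule tensor_lift_comp_linear) (rule tensor_of_linear)
  also have "\<dots> = 0"
    using assms clinearD(3)[OF tensor_of_linear(1)] by (simp add: ker_mu_def)
  finally show ?thesis
    by (simp add: tensor_lift_tensor_of_id)
qed

text \<open>The induced coactions are \<open>\<eta> \<mapsto> \<Sum>\<^sub>m t\<^sub>m \<otimes> K_comp \<theta> \<eta> m\<close> and \<open>\<eta> \<mapsto> \<Sum>\<^sub>n H_comp \<theta> \<eta> n \<otimes> t\<^sup>n\<close>.\<close>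

definition K_comp :: "real \<Rightarrow> sphere2 set \<Rightarrow> int \<times> int \<Rightarrow> sphere2 set" where
  "K_comp \<theta> \<eta> m = Poly_Mapping.lookup (coact_K2 (rep \<eta>)) m +o ker_mu_sq \<theta>"

definition H_comp :: "real \<Rightarrow> sphere2 set \<Rightarrow> int \<Rightarrow> sphere2 set" where
  "H_comp \<theta> \<eta> n = Poly_Mapping.lookup (coact_H2 (rep \<eta>)) n +o ker_mu_sq \<theta>"

definition K_supp :: "real \<Rightarrow> sphere2 set \<Rightarrow> (int \<times> int) set" where
  "K_supp \<theta> \<eta> = {m. K_comp \<theta> \<eta> m \<noteq> ker_mu_sq \<theta>}"

definition H_coinvariant :: "real \<Rightarrow> sphere2 set \<Rightarrow> bool" where
  "H_coinvariant \<theta> \<eta> \<longleftrightarrow> (\<forall>n. H_comp \<theta> \<eta> n = (if n = 0 then \<eta> else ker_mu_sq \<theta>))"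

text \<open>The linear map given by \<open>a d\<^sub>\<theta>a' \<mapsto> f a a'\<close>. It is the lift of \<open>f\<close> to a representative, because
  the class of \<open>\<Sum> a \<otimes> a' \<in> ker \<mu>\<^sub>\<theta>\<close> is \<open>\<Sum> a d\<^sub>\<theta>a'\<close> (see \<open>ker_mu_expansion\<close> below). The values of
  \<open>f\<close> may again be representatives of elements of a quotient.\<close>

definition on_forms :: "(sphere \<Rightarrow> sphere \<Rightarrow> 'v) \<Rightarrow> sphere2 set \<Rightarrow> 'v::complex_vector" where
  "on_forms f \<eta> = tensor_lift f (rep \<eta>)"

text \<open>\<open>X\<close> on the basis \<open>t\<^sup>n\<close> of \<open>H\<close>, and \<open>a \<mapsto> a\<^sub>0 X(a\<^sub>1)\<close>.\<close>

definition X :: "int \<Rightarrow> complex" where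
  "X n = of_int n"

definition vert :: "sphere \<Rightarrow> sphere" where
  "vert a = weight_sum (coact_H a) (\<lambda>n x. X n *\<^sub>C x)"

definition ver :: "real \<Rightarrow> sphere2 set \<Rightarrow> sphere" where
  "ver \<theta> = on_forms (\<lambda>a a'. star \<theta> a (vert a'))"

definition Con :: "real \<Rightarrow> sphere2 set set" where
  "Con \<theta> = {\<omega> \<in> Omega1 \<theta>. H_coinvariant \<theta> \<omega> \<and> ver \<theta> \<omega> = 1}"

text \<open>The left \<open>A\<^sub>\<theta>\<close>-action of \<open>\<Omega>\<^sup>1(A)\<^sub>\<theta>\<close> on representatives, and the map
  \<open>a d\<^sub>\<theta>a' \<mapsto> a \<star>\<^sub>\<theta> da'\<close> into \<open>\<Omega>\<^sup>1(A)\<^sub>\<theta>\<close>.\<close>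

definition deformed_lmult :: "real \<Rightarrow> sphere \<Rightarrow> sphere2 \<Rightarrow> sphere2" where
  "deformed_lmult \<theta> a t = weight_sum (coact_K a) (\<lambda>m x. weight_sum (coact_K2 t) (\<lambda>n s.
     sigma \<theta> m n *\<^sub>C lmult 0 x s))"

definition phi :: "real \<Rightarrow> sphere2 set \<Rightarrow> sphere2 set" where
  "phi \<theta> \<eta> = on_forms (\<lambda>a a'. deformed_lmult \<theta> a (delta2 a')) \<eta> +o ker_mu_sq 0"


section \<open>Two-forms\<close>

text \<open>The degree two part of the braided exterior algebra, as the quotient of the free vector space on
  pairs of one-forms by the relations of \<open>\<Omega>\<^sup>1(A\<^sub>\<theta>) \<otimes> \<Omega>\<^sup>1(A\<^sub>\<theta>)\<close> (tensor product over \<open>A\<^sub>\<theta>\<close>) and by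
  \<open>\<eta> \<otimes> \<nu> + R\<^sub>\<theta>(\<nu>\<^sub>-\<^sub>1 \<otimes> \<eta>\<^sub>-\<^sub>1) \<nu>\<^sub>0 \<otimes> \<eta>\<^sub>0\<close>. Modulo the former, the linear span of the latter is already
  a sub-bimodule, because \<open>a \<eta> = R\<^sub>\<theta>(\<eta>\<^sub>-\<^sub>1 \<otimes> a\<^sub>-\<^sub>1) \<eta>\<^sub>0 a\<^sub>0\<close> in \<open>\<Omega>\<^sup>1(A\<^sub>\<theta>)\<close>. The differential and the
  contraction take a one-form to forms of degree at most two, so higher degrees do not enter the
  action of \<open>\<zeta>\<close> on a one-form.\<close>

type_synonym form_pairs = "sphere2 set \<times> sphere2 set \<Rightarrow>\<^sub>0 complex"

abbreviation pair :: "sphere2 set \<Rightarrow> sphere2 set \<Rightarrow> form_pairs" where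
  "pair \<eta> \<nu> \<equiv> Poly_Mapping.single (\<eta>, \<nu>) 1"

definition wedge_null :: "real \<Rightarrow> form_pairs set" where
  "wedge_null \<theta> = cspan
     ({pair (\<kappa> + \<eta>) \<nu> - pair \<kappa> \<nu> - pair \<eta> \<nu>
         | \<kappa> \<eta> \<nu>. \<kappa> \<in> Omega1 \<theta> \<and> \<eta> \<in> Omega1 \<theta> \<and> \<nu> \<in> Omega1 \<theta>}
    \<union> {pair \<kappa> (\<eta> + \<nu>) - pair \<kappa> \<eta> - pair \<kappa> \<nu>
         | \<kappa> \<eta> \<nu>. \<kappa> \<in> Omega1 \<theta> \<and> \<eta> \<in> Omega1 \<theta> \<and> \<nu> \<in> Omega1 \<theta>}
    \<union> {pair (lact \<theta> (c *\<^sub>C 1) \<eta>) \<nu> - c *\<^sub>C pair \<eta> \<nu>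
         | c \<eta> \<nu>. \<eta> \<in> Omega1 \<theta> \<and> \<nu> \<in> Omega1 \<theta>}
    \<union> {pair (ract \<theta> \<eta> a) \<nu> - pair \<eta> (lact \<theta> a \<nu>)
         | a \<eta> \<nu>. \<eta> \<in> Omega1 \<theta> \<and> \<nu> \<in> Omega1 \<theta>}
    \<union> {pair \<eta> \<nu> + (\<Sum>m\<in>K_supp \<theta> \<eta>. \<Sum>n\<in>K_supp \<theta> \<nu>.
           Rmat \<theta> n m *\<^sub>C pair (K_comp \<theta> \<nu> n) (K_comp \<theta> \<eta> m))
         | \<eta> \<nu>. \<eta> \<in> Omega1 \<theta> \<and> \<nu> \<in> Omega1 \<theta>})"

definition Omega2 :: "real \<Rightarrow> form_pairs set set" where
  "Omega2 \<theta> = {w +o wedge_null \<theta> | w. Poly_Mapping.keys w \<subseteq> Omega1 \<theta> \<times> Omega1 \<theta>}"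

text \<open>The convention \<open>d(\<eta> \<and> \<nu>) = \<eta> \<and> d\<nu> + (-1)\<^sup>m d\<eta> \<and> \<nu>\<close> with \<open>m\<close> the degree of \<open>\<nu>\<close> yields
  \<open>d\<^sub>\<theta>(a d\<^sub>\<theta>a') = - d\<^sub>\<theta>a \<and> d\<^sub>\<theta>a'\<close>.\<close>

definition d1 :: "real \<Rightarrow> sphere2 set \<Rightarrow> form_pairs set" where
  "d1 \<theta> \<eta> = on_forms (\<lambda>a a'. - pair (d0 \<theta> a) (d0 \<theta> a')) \<eta> +o wedge_null \<theta>"


section \<open>Infinitesimal gauge transformations\<close>

text \<open>The gauge parameter \<open>\<zeta> = b \<otimes> X\<close> is represented by \<open>b \<in> base\<close>.\<close>

definition iota1 :: "real \<Rightarrow> sphere \<Rightarrow> sphere2 set \<Rightarrow> sphere" where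
  "iota1 \<theta> b \<eta> = star \<theta> (ver \<theta> \<eta>) b"

text \<open>A representative of
  \<open>\<iota>\<^sub>\<zeta>(\<eta> \<and> \<nu>) = \<eta> \<iota>\<^sub>\<zeta>(\<nu>) - R\<^sub>\<theta>(\<zeta>\<^sub>-\<^sub>1 \<otimes> \<nu>\<^sub>-\<^sub>1) \<iota>\<^bsub>\<zeta>\<^sub>0\<^esub>(\<eta>) \<nu>\<^sub>0\<close> for one-forms \<open>\<eta>, \<nu>\<close>.\<close>

definition iota_pair :: "real \<Rightarrow> sphere \<Rightarrow> sphere2 set \<Rightarrow> sphere2 set \<Rightarrow> sphere2" where
  "iota_pair \<theta> b \<eta> \<nu> = rmult \<theta> (rep \<eta>) (iota1 \<theta> b \<nu>) -
     weight_sum (coact_K b) (\<lambda>m x. weight_sum (coact_K2 (rep \<nu>)) (\<lambda>n t.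
       Rmat \<theta> m n *\<^sub>C lmult \<theta> (iota1 \<theta> x \<eta>) t))"

definition iota2 :: "real \<Rightarrow> sphere \<Rightarrow> form_pairs set \<Rightarrow> sphere2 set" where
  "iota2 \<theta> b w = free_lift (\<lambda>(\<eta>, \<nu>). iota_pair \<theta> b \<eta> \<nu>) (rep w) +o ker_mu_sq \<theta>"

definition gauge_act :: "real \<Rightarrow> sphere2 set \<Rightarrow> sphere \<Rightarrow> sphere2 set" where
  "gauge_act \<theta> \<omega> b = d0 \<theta> (iota1 \<theta> b \<omega>) + iota2 \<theta> b (d1 \<theta> \<omega>)"

end

theory Submission
  imports Defs
begin

text \<open>
  The linear map \<open>\<Phi>(x \<otimes> y) = \<sigma>\<^sub>\<theta>(m \<otimes> n) x \<otimes> y\<close>, for \<open>x, y\<close> of \<open>K\<close>-weights \<open>m, n\<close>, turns the product of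
  the braided tensor algebra \<open>A\<^sub>\<theta> \<otimes> A\<^sub>\<theta>\<close> into that of \<open>A \<otimes> A\<close>, up to the factor \<open>\<sigma>\<^sub>\<theta>\<close> of the total
  weights, and intertwines \<open>\<mu>\<^sub>\<theta>\<close> and \<open>ver\<^sub>\<theta>\<close> with \<open>\<mu>\<close> and \<open>ver\<close>. Hence it maps \<open>(ker \<mu>\<^sub>\<theta>)\<^sup>2\<close> onto \<open>(ker \<mu>)\<^sup>2\<close>
  and induces the bijection of connections. It also reduces the computations with contractions to
  \<open>\<theta> = 0\<close>: on homogeneous arguments the contraction of \<open>\<eta> \<and> \<nu>\<close> with \<open>b \<otimes> X\<close> becomes a common phase times
  \<open>b (ver(\<nu>) \<eta> - ver(\<eta>) \<nu>)\<close>.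

  For a connection \<open>\<omega>\<close>, Cartan's formula together with \<open>ver(\<omega>) = 1\<close> and the \<open>H\<close>-coinvariance of \<open>\<omega>\<close> gives
  \<open>\<iota>\<^sub>\<zeta>(d\<omega>) = 0\<close>, in every weight component. So \<open>\<zeta> = b \<otimes> X\<close> sends every connection to \<open>d\<^sub>\<theta>b\<close>, which
  corresponds to \<open>db\<close> under \<open>\<Phi>\<close>.
\<close>

section \<open>Linear maps\<close>

abbreviation clin :: "('a::complex_vector \<Rightarrow> 'b::complex_vector) \<Rightarrow> bool" where
  "clin \<equiv> Vector_Spaces.linear scaleC scaleC"

lemma clin_id: "clin (\<lambda>x. x)"
  by (rule clinearI) simp_all

lemma clin_diffD:
  assumes "clin f"
  shows "f (x - y) = f x - f y" "f (- x) = - f x"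
proof -
  have "f (- x) = - f x" for x
    using clinearD(2)[OF assms, of "-1" x] by simp
  then show "f (x - y) = f x - f y" "f (- x) = - f x"
    using clinearD(1)[OF assms, of x "- y"] by simp_all
qed

lemma clin_compose: "clin f \<Longrightarrow> clin g \<Longrightarrow> clin (\<lambda>x. f (g x))"
  by (rule clinearI) (simp_all add: clinearD)

lemma clin_add: "clin f \<Longrightarrow> clin g \<Longrightarrow> clin (\<lambda>x. f x + g x)"
  by (rule clinearI) (simp_all add: clinearD scaleC_add_right)

lemma clin_uminus: "clin f \<Longrightarrow> clin (\<lambda>x. - f x)"
  by (rule clinearI) (simp_all add: clinearD)

lemma clin_diff: "clin f \<Longrightarrow> clin g \<Longrightarrow> clin (\<lambda>x. f x - g x)"
  by (rule clinearI) (simp_all add: clinearD cvec.scale_right_diff_distrib)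

lemma clin_scaleC: "clin f \<Longrightarrow> clin (\<lambda>x. c *\<^sub>C f x)"
  by (rule clinearI) (simp_all add: clinearD scaleC_add_right scaleC_scaleC mult.commute)

lemma clin_single: "clin f \<Longrightarrow> clin (\<lambda>x. Poly_Mapping.single k (f x))"
  by (rule clinearI) (auto intro!: poly_mapping_eqI simp: clinearD single_add lookup_single when_def)

lemma clin_lookup: "clin f \<Longrightarrow> clin (\<lambda>x. Poly_Mapping.lookup (f x) k)"
  by (rule clinearI) (simp_all add: clinearD lookup_add)

lemma sphere_mult_scaleC: "a * c *\<^sub>C b = c *\<^sub>C (a * b)" for a b :: sphere
  by (metis mult.commute scaleC_sphere_mult)

lemma clin_mult_left: "clin f \<Longrightarrow> clin (\<lambda>x. f x * (a::sphere))"
  by (rule clinearI) (simp_all add: clinearD distrib_right scaleC_sphere_mult)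

lemma clin_mult_right: "clin f \<Longrightarrow> clin (\<lambda>x. (a::sphere) * f x)"
  by (rule clinearI) (simp_all add: clinearD distrib_left sphere_mult_scaleC)

lemma clin_tensor_left: "clin f \<Longrightarrow> clin (\<lambda>x. f x \<otimes> y)"
  by (rule clinearI) (simp_all add: clinearD tensor_of_simps)

lemma clin_tensor_right: "clin f \<Longrightarrow> clin (\<lambda>x. y \<otimes> f x)"
  by (rule clinearI) (simp_all add: clinearD tensor_of_simps)

lemma clin_star_left: "clin f \<Longrightarrow> clin (\<lambda>x. star \<theta> (f x) a)"
  by (rule clinearI) (simp_all add: clinearD cbilinearD[OF star_bilinear])

lemma clin_star_right: "clin f \<Longrightarrow> clin (\<lambda>x. star \<theta> a (f x))"
  by (rule clinearI) (simp_all add: clinearD cbilinearD[OF star_bilinear])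

lemma clin_coact_K: "clin f \<Longrightarrow> clin (\<lambda>x. coact_K (f x))"
  by (rule clinearI) (simp_all add: clinearD coact_K_add coact_K_scale)

section \<open>The coactions as linear algebra maps\<close>

lemma coact_H_add: "coact_H (a + b) = coact_H a + coact_H b"
  by transfer (rule coeff_hom.poly_subst_add[OF coeff_hom_single])

lemma coact_K_mult: "coact_K (a * b) = coact_K a * coact_K b"
  by transfer (rule coeff_hom.poly_subst_mult[OF coeff_hom_single])

lemma coact_H_mult: "coact_H (a * b) = coact_H a * coact_H b"
  by transfer (rule coeff_hom.poly_subst_mult[OF coeff_hom_single])

lemma coact_H_scale: "coact_H (c *\<^sub>C a) = c *\<^sub>C coact_H a"
proof (transfer, goal_cases)
  case (1 c p)
  have "Poly_Mapping.single 0 (c *\<^sub>C (1::sphere)) * q = c *\<^sub>C q" for q :: "int \<Rightarrow>\<^sub>0 sphere"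
    by (induction q rule: poly_mapping_single_induct)
      (auto intro!: poly_mapping_eqI simp: mult_single scaleC_sphere_mult lookup_single when_def
        distrib_left scaleC_add_right)
  then show ?case
    by (simp add: scaleC_sphere_poly coeff_hom.poly_subst_mult[OF coeff_hom_single]
        coeff_hom.poly_subst_single[OF coeff_hom_single])
qed

lemma coact_H_one: "coact_H 1 = Poly_Mapping.single 0 1"
  by transfer (simp add: coeff_hom.poly_subst_one[OF coeff_hom_single])

lemma clin_coact_H: "clin f \<Longrightarrow> clin (\<lambda>x. coact_H (f x))"
  by (rule clinearI) (simp_all add: clinearD coact_H_add coact_H_scale)

section \<open>Linearity of Sweedler sums and of lifts to the tensor product\<close>

lemma clin_weight_sum_arg:
  assumes c: "clin c" and f: "\<And>m. clin (f m)"
  shows "clin (\<lambda>z. weight_sum (c z) f)"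
proof (rule clinearI)
  show "weight_sum (c (x + y)) f = weight_sum (c x) f + weight_sum (c y) f" for x y
    unfolding clinearD(1)[OF c] by (rule weight_sum_add) (simp_all add: clinearD[OF f])
  show "weight_sum (c (s *\<^sub>C x)) f = s *\<^sub>C weight_sum (c x) f" for s x
    unfolding clinearD(2)[OF c] by (rule weight_sum_scale) (simp_all add: clinearD[OF f])
qed

lemma clin_weight_sum_fun:
  assumes "\<And>m x. clin (\<lambda>z. f z m x)"
  shows "clin (\<lambda>z. weight_sum p (f z))"
  by (rule clinearI)
    (simp_all add: weight_sum_def clinearD[OF assms] sum.distrib cvec.scale_sum_right)

lemma cbilinear_clin: "(\<And>y. clin (\<lambda>x. f x y)) \<Longrightarrow> (\<And>x. clin (f x)) \<Longrightarrow> cbilinear f"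
  by (simp add: cbilinear_def)

lemma tensor_lift_add_scale:
  assumes "cbilinear f"
  shows "tensor_lift f (s + t) = tensor_lift f s + tensor_lift f t"
    and "tensor_lift f (c *\<^sub>C t) = c *\<^sub>C tensor_lift f t"
proof -
  obtain p q where "s = abs_tensor p" "t = abs_tensor q"
    by (metis Quotient3_abs_rep[OF Quotient3_tensor])
  then show "tensor_lift f (s + t) = tensor_lift f s + tensor_lift f t"
    "tensor_lift f (c *\<^sub>C t) = c *\<^sub>C tensor_lift f t"
    by (simp_all add: plus_tensor.abs_eq scaleC_tensor.abs_eq tensor_lift_abs[OF assms]
        free_lift_add free_lift_scaleC)
qed

lemma clin_tensor_lift_arg: "cbilinear f \<Longrightarrow> clin g \<Longrightarrow> clin (\<lambda>z. tensor_lift f (g z))"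
  by (rule clinearI) (simp_all add: clinearD tensor_lift_add_scale)

lemma clin_tensor_lift_fun:
  assumes "\<And>x y. clin (\<lambda>z. f z x y)"
  shows "clin (\<lambda>z. tensor_lift (f z) t)"
  by (rule clinearI)
    (simp_all add: tensor_lift_def free_lift_def case_prod_unfold clinearD[OF assms] sum.distrib
      scaleC_add_right cvec.scale_sum_right scaleC_scaleC mult.commute)

text \<open>Used with \<open>intro\<close> as a syntax-directed calculus: the outermost operation is
  peeled off until \<open>clin_id\<close> closes the goal.\<close>

lemmas clin_intros = clin_id clin_add clin_uminus clin_diff clin_scaleC clin_single clin_lookup
  clin_mult_left clin_mult_right clin_tensor_left clin_tensor_right clin_star_left clin_star_right
  clin_coact_K clin_coact_H clin_weight_sum_arg clin_weight_sum_fun cbilinear_clin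
  clin_tensor_lift_arg clin_tensor_lift_fun

section \<open>Linearity of the structure maps\<close>

lemma cbilinear_coact_K2: "cbilinear (\<lambda>a a'. weight_sum (coact_K a) (\<lambda>m x.
     weight_sum (coact_K a') (\<lambda>n y. Poly_Mapping.single (m + n) (x \<otimes> y))))"
  by (intro clin_intros)

lemma cbilinear_coact_H2: "cbilinear (\<lambda>a a'. weight_sum (coact_H a) (\<lambda>m x.
     weight_sum (coact_H a') (\<lambda>n y. Poly_Mapping.single (m + n) (x \<otimes> y))))"
  by (intro clin_intros)

lemma clin_vert: "clin f \<Longrightarrow> clin (\<lambda>x. vert (f x))"
  unfolding vert_def by (intro clin_intros)

lemma clin_delta2: "clin f \<Longrightarrow> clin (\<lambda>x. delta2 (f x))"
  unfolding delta2_def by (intro clin_intros)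

lemma clin_coact_K2: "clin f \<Longrightarrow> clin (\<lambda>x. coact_K2 (f x))"
  unfolding coact_K2_def by (intro clin_intros)

lemma clin_coact_H2: "clin f \<Longrightarrow> clin (\<lambda>x. coact_H2 (f x))"
  unfolding coact_H2_def by (intro clin_intros)

lemma clin_mu: "clin f \<Longrightarrow> clin (\<lambda>x. mu \<theta> (f x))"
  unfolding mu_def by (intro clin_intros)

lemma clin_lmult_left: "clin f \<Longrightarrow> clin (\<lambda>x. lmult \<theta> (f x) t)"
  unfolding lmult_def by (intro clin_intros)

lemma clin_lmult_right: "clin f \<Longrightarrow> clin (\<lambda>x. lmult \<theta> a (f x))"
  unfolding lmult_def by (intro clin_intros)

lemma clin_rmult_left: "clin f \<Longrightarrow> clin (\<lambda>x. rmult \<theta> (f x) a)"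
  unfolding rmult_def by (intro clin_intros)

lemma clin_rmult_right: "clin f \<Longrightarrow> clin (\<lambda>x. rmult \<theta> t (f x))"
  unfolding rmult_def by (intro clin_intros)

lemma cbilinear_braided_mult_aux:
  "cbilinear (\<lambda>b b'. weight_sum (coact_K b) (\<lambda>m x. weight_sum (coact_K a') (\<lambda>n y.
       Rmat \<theta> m n *\<^sub>C (star \<theta> a x \<otimes> star \<theta> y b'))))"
  by (intro clin_intros)

lemma cbilinear_braided_mult:
  "cbilinear (\<lambda>a a'. tensor_lift (\<lambda>b b'.
     weight_sum (coact_K b) (\<lambda>m x. weight_sum (coact_K a') (\<lambda>n y.
       Rmat \<theta> m n *\<^sub>C (star \<theta> a x \<otimes> star \<theta> y b')))) t)"
  by (intro clin_intros)

lemma clin_braided_mult_left: "clin f \<Longrightarrow> clin (\<lambda>x. braided_mult \<theta> (f x) t)"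
  unfolding braided_mult_def by (intro clin_intros)

lemma clin_braided_mult_right: "clin f \<Longrightarrow> clin (\<lambda>x. braided_mult \<theta> s (f x))"
  unfolding braided_mult_def by (intro clin_intros)

section \<open>Homogeneous elements\<close>

abbreviation h_weight :: "int \<times> int \<Rightarrow> int" where
  "h_weight m \<equiv> fst m + snd m"

text \<open>The \<open>H\<close>-grading coarsens the \<open>K\<close>-grading: the \<open>H\<close>-weight is the sum of the two \<open>K\<close>-weights.\<close>

definition hom :: "int \<times> int \<Rightarrow> sphere \<Rightarrow> bool" where
  "hom m a \<longleftrightarrow> coact_K a = Poly_Mapping.single m a \<and> coact_H a = Poly_Mapping.single (h_weight m) a"

definition hom2 :: "int \<times> int \<Rightarrow> sphere2 \<Rightarrow> bool" where
  "hom2 m t \<longleftrightarrow> coact_K2 t = Poly_Mapping.single m t \<and> coact_H2 t = Poly_Mapping.single (h_weight m) t"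

lemma homD: "hom m a \<Longrightarrow> coact_K a = Poly_Mapping.single m a"
  "hom m a \<Longrightarrow> coact_H a = Poly_Mapping.single (h_weight m) a"
  by (simp_all add: hom_def)

lemma hom2D: "hom2 m t \<Longrightarrow> coact_K2 t = Poly_Mapping.single m t"
  "hom2 m t \<Longrightarrow> coact_H2 t = Poly_Mapping.single (h_weight m) t"
  by (simp_all add: hom2_def)

lemma single_scaleC: "Poly_Mapping.single k (c *\<^sub>C x) = c *\<^sub>C Poly_Mapping.single k x"
  using clinearD(2)[OF clin_single[OF clin_id]] .

lemma hom_one: "hom 0 1"
  by (simp add: hom_def coact_K_one coact_H_one)

lemma hom_zero: "hom m 0"
  by (simp add: hom_def clinearD(3)[OF clin_coact_K[OF clin_id]] clinearD(3)[OF clin_coact_H[OF clin_id]])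

lemma hom_scaleC: "hom m a \<Longrightarrow> hom m (c *\<^sub>C a)"
  by (simp add: hom_def coact_K_scale coact_H_scale single_scaleC)

lemma hom_mult: "hom m a \<Longrightarrow> hom n b \<Longrightarrow> hom (m + n) (a * b)"
  by (simp add: hom_def coact_K_mult coact_H_mult mult_single algebra_simps)

lemma hom_zgen: "hom (K_weight g) (zgen g)"
proof -
  have "coact_K (zgen g) = Poly_Mapping.single (K_weight g) (zgen g)"
    by transfer (rule coeff_hom.poly_subst_var[OF coeff_hom_single])
  moreover have "coact_H (zgen g) = Poly_Mapping.single (H_weight g) (zgen g)"
    by transfer (rule coeff_hom.poly_subst_var[OF coeff_hom_single])
  moreover have "H_weight g = h_weight (K_weight g)"
    by (cases g) simp_all
  ultimately show ?thesis by (simp add: hom_def)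
qed

section \<open>Reduction to homogeneous elements\<close>

lemma hom_prod_power: "finite G \<Longrightarrow> \<exists>m. hom m (\<Prod>g\<in>G. zgen g ^ k g)"
proof (induction rule: finite_induct)
  case (insert g G)
  have "\<exists>m. hom m (zgen g ^ n)" for n
  proof (induction n)
    case (Suc n)
    then obtain m where "hom m (zgen g ^ n)" by blast
    from hom_mult[OF hom_zgen this, of g] show ?case unfolding power_Suc by blast
  qed (use hom_one in \<open>simp only: power_0, blast\<close>)
  then obtain m m' where "hom m (zgen g ^ k g)" "hom m' (\<Prod>g\<in>G. zgen g ^ k g)"
    using insert.IH by meson
  from hom_mult[OF this] show ?case
    unfolding prod.insert[OF insert.hyps] by blast
qed (use hom_one in \<open>simp only: prod.empty, blast\<close>)

text \<open>Monomials in the generators are homogeneous and span the algebra. Scalars are absorbed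
  by \<open>hom_scaleC\<close> and zero is homogeneous of every weight, so no further cases
  arise.\<close>

lemma sphere_hom_induct [case_names hom add]:
  assumes hom: "\<And>m a. hom m a \<Longrightarrow> P a" and add: "\<And>a b. P a \<Longrightarrow> P b \<Longrightarrow> P (a + b)"
  shows "P a"
proof -
  have "P (poly_subst (\<lambda>c. c *\<^sub>C 1) zgen p)" for p
  proof (induction p rule: poly_mapping_single_induct)
    case zero
    show ?case by (simp add: coeff_hom.poly_subst_zero[OF coeff_hom_scale_one] hom[OF hom_zero])
  next
    case (single k v)
    obtain m where "hom m (\<Prod>g\<in>UNIV. zgen g ^ Poly_Mapping.lookup k g)"
      using hom_prod_power[OF finite] by blast
    then show ?case
      by (simp add: coeff_hom.poly_subst_single[OF coeff_hom_scale_one] scaleC_sphere_mult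
          hom[OF hom_scaleC])
  qed (simp add: coeff_hom.poly_subst_add[OF coeff_hom_scale_one] add)
  moreover obtain p where "a = abs_sphere p"
    by (metis Quotient3_abs_rep[OF Quotient3_sphere])
  ultimately show ?thesis by (simp add: poly_subst_zgen)
qed

text \<open>Pure tensors absorb scalars in the left factor and include zero as
  \<open>0 \<otimes> 0\<close>, so additivity is the only closure condition.\<close>

lemma tensor_induct [case_names tensor add]:
  assumes tensor: "\<And>x y. P (x \<otimes> y)" and add: "\<And>s t. P s \<Longrightarrow> P t \<Longrightarrow> P (s + t)"
  shows "P t"
proof -
  have "P (free_lift (\<lambda>(x, y). x \<otimes> y) p)" for p :: "'a \<times> 'b \<Rightarrow>\<^sub>0 complex"
  proof (induction p rule: poly_mapping_single_induct)
    case zero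
    show ?case
      using tensor[of 0 0] by (simp add: free_lift_def clinearD(3)[OF tensor_of_linear(1)])
  next
    case (single k v)
    then show ?case
      by (cases k) (simp add: free_lift_single flip: tensor_of_scale_left, rule tensor)
  qed (simp add: free_lift_add add)
  moreover obtain p where "t = abs_tensor p"
    by (metis Quotient3_abs_rep[OF Quotient3_tensor])
  ultimately show ?thesis by (simp add: abs_tensor_free_lift)
qed

lemma tensor_hom_induct [case_names tensor add]:
  assumes tensor: "\<And>m n x y. hom m x \<Longrightarrow> hom n y \<Longrightarrow> P (x \<otimes> y)"
    and add: "\<And>s t. P s \<Longrightarrow> P t \<Longrightarrow> P (s + t)"
  shows "P t"
proof (induction t rule: tensor_induct)
  case (tensor x y)
  show ?case
  proof (induction x rule: sphere_hom_induct)
    case (hom m x)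
    show ?case
      by (induction y rule: sphere_hom_induct)
        (simp_all add: assms(1)[OF hom] add tensor_of_add_right)
  qed (simp add: add tensor_of_add_left)
qed (rule add)

lemma clin_eq_hom:
  assumes "clin F" "clin G" "\<And>m x. hom m x \<Longrightarrow> F x = G x"
  shows "F a = G a"
  by (induction a rule: sphere_hom_induct) (simp_all add: assms(3) clinearD[OF assms(1)] clinearD[OF assms(2)])

text \<open>The standard way to check an identity of linear maps on \<open>sphere2\<close>: on
  homogeneous pure tensors the coactions and deformed products are explicit phases.\<close>

lemma clin_eq_hom2:
  assumes "clin F" "clin G" "\<And>m n x y. hom m x \<Longrightarrow> hom n y \<Longrightarrow> F (x \<otimes> y) = G (x \<otimes> y)"
  shows "F t = G t"
  by (induction t rule: tensor_hom_induct) (simp_all add: assms(3) clinearD[OF assms(1)] clinearD[OF assms(2)])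

lemma coact_K2_tensor: "hom m x \<Longrightarrow> hom n y \<Longrightarrow>
    coact_K2 (x \<otimes> y) = Poly_Mapping.single (m + n) (x \<otimes> y)"
  by (simp add: coact_K2_def tensor_lift_tensor_of[OF cbilinear_coact_K2] homD weight_sum_single
      clinearD(3)[OF tensor_of_linear(1)] clinearD(3)[OF tensor_of_linear(2)])

lemma coact_H2_tensor: "hom m x \<Longrightarrow> hom n y \<Longrightarrow>
    coact_H2 (x \<otimes> y) = Poly_Mapping.single (h_weight (m + n)) (x \<otimes> y)"
  by (simp add: coact_H2_def tensor_lift_tensor_of[OF cbilinear_coact_H2] homD weight_sum_single
      clinearD(3)[OF tensor_of_linear(1)] clinearD(3)[OF tensor_of_linear(2)] algebra_simps)

lemma hom2_tensor: "hom m x \<Longrightarrow> hom n y \<Longrightarrow> hom2 (m + n) (x \<otimes> y)"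
  by (simp add: hom2_def coact_K2_tensor coact_H2_tensor)

lemma hom2_zero: "hom2 m 0"
  by (simp add: hom2_def clinearD(3)[OF clin_coact_K2[OF clin_id]] clinearD(3)[OF clin_coact_H2[OF clin_id]])

lemma hom2_add: "hom2 m s \<Longrightarrow> hom2 m t \<Longrightarrow> hom2 m (s + t)"
  by (simp add: hom2_def clinearD(1)[OF clin_coact_K2[OF clin_id]]
      clinearD(1)[OF clin_coact_H2[OF clin_id]] single_add)

lemma hom2_scaleC: "hom2 m t \<Longrightarrow> hom2 m (c *\<^sub>C t)"
  by (simp add: hom2_def clinearD(2)[OF clin_coact_K2[OF clin_id]]
      clinearD(2)[OF clin_coact_H2[OF clin_id]] single_scaleC)

lemma hom2_diff: "hom2 m s \<Longrightarrow> hom2 m t \<Longrightarrow> hom2 m (s - t)"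
  using hom2_add[of m s "- 1 *\<^sub>C t"] hom2_scaleC[of m t "-1"] by simp

lemma hom2_comp: "hom2 m (Poly_Mapping.lookup (coact_K2 t) m)"
  by (induction t rule: tensor_hom_induct)
    (simp_all add: coact_K2_tensor lookup_single when_def hom2_zero
      clinearD(1)[OF clin_coact_K2[OF clin_id]] lookup_add hom2_add, metis hom2_tensor)

text \<open>Projection to the component of weight \<open>M\<close> fixes \<open>t\<close> and kills
  homogeneous pure tensors of any other total weight. Identities with phases that depend on the
  total weight need this form.\<close>

lemma clin_eq_on_hom2:
  assumes "clin F" "clin G" "hom2 M t"
    and "\<And>m n x y. hom m x \<Longrightarrow> hom n y \<Longrightarrow> M = m + n \<Longrightarrow> F (x \<otimes> y) = G (x \<otimes> y)"
  shows "F t = G t"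
proof -
  have "F (Poly_Mapping.lookup (coact_K2 t) M) = G (Poly_Mapping.lookup (coact_K2 t) M)"
    by (rule clin_eq_hom2; (intro clin_compose[OF assms(1)] clin_compose[OF assms(2)] clin_lookup
          clin_coact_K2 clin_id)?)
      (auto simp: coact_K2_tensor lookup_single when_def assms(4) clinearD(3)[OF assms(1)]
        clinearD(3)[OF assms(2)])
  then show ?thesis by (simp add: hom2D[OF assms(3)])
qed

section \<open>Graded subspaces\<close>

lemma coact_K2_counit: "weight_sum (coact_K2 t) (\<lambda>m x. x) = t"
  by (rule clin_eq_hom2; (intro clin_weight_sum_arg clin_coact_K2 clin_id)?)
    (simp add: coact_K2_tensor weight_sum_single)

definition graded :: "sphere2 set \<Rightarrow> bool" where
  "graded U \<longleftrightarrow> csubspace U \<and> (\<forall>t\<in>U. \<forall>m. Poly_Mapping.lookup (coact_K2 t) m \<in> U)"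

text \<open>An element is the sum of its weight components, and gradedness keeps these in
  \<open>U\<close>. So linear conditions can be tested on homogeneous elements of a kernel, whose
  elements need not split into pure tensors inside it.\<close>

lemma graded_clin_mem:
  assumes "graded U" "clin F" "csubspace S" "t \<in> U"
    and "\<And>m s. hom2 m s \<Longrightarrow> s \<in> U \<Longrightarrow> F s \<in> S"
  shows "F t \<in> S"
proof -
  have "F t = F (weight_sum (coact_K2 t) (\<lambda>m x. x))"
    by (simp add: coact_K2_counit)
  also have "\<dots> = (\<Sum>m\<in>Poly_Mapping.keys (coact_K2 t). F (Poly_Mapping.lookup (coact_K2 t) m))"
    by (simp add: weight_sum_def clinearD(4)[OF assms(2)])
  also have "\<dots> \<in> S"
    using assms(1,4) unfolding graded_def by (intro cvec.subspace_sum[OF assms(3)] assms(5)[OF hom2_comp]) blast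
  finally show ?thesis .
qed

lemma hom_clin_mem:
  assumes "clin F" "csubspace S" "\<And>m a. hom m a \<Longrightarrow> F a \<in> S"
  shows "F a \<in> S"
  by (induction a rule: sphere_hom_induct)
    (simp_all add: assms(3) clinearD[OF assms(1)] cvec.subspace_add[OF assms(2)])

text \<open>\<open>graded\<close> speaks of components under K; each of these is also homogeneous
  under H, which gives the components under H.\<close>

lemma graded_lookup_H:
  assumes "graded U" "t \<in> U"
  shows "Poly_Mapping.lookup (coact_H2 t) n \<in> U"
  by (rule graded_clin_mem[OF assms(1) _ _ assms(2)])
    (use assms(1) in \<open>auto intro!: clin_lookup clin_coact_H2 clin_id
      simp: hom2D lookup_single when_def graded_def cvec.subspace_0\<close>)

section \<open>Bicharacter identities for the phases\<close>

lemma sigma_add_left: "sigma \<theta> (m + m') n = sigma \<theta> m n * sigma \<theta> m' n"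
  by (cases m; cases m'; cases n) (simp add: exp_add[symmetric] algebra_simps)

lemma sigma_add_right: "sigma \<theta> m (n + n') = sigma \<theta> m n * sigma \<theta> m n'"
  by (cases m; cases n; cases n') (simp add: exp_add[symmetric] algebra_simps)

lemma sigma_nonzero: "sigma \<theta> m n \<noteq> 0"
  by (cases m; cases n) simp

lemma sigma_swap: "sigma \<theta> m n * sigma \<theta> n m = 1"
  by (cases m; cases n) (simp add: exp_add[symmetric] algebra_simps)

text \<open>Antisymmetry of the exponent makes \<sigma> with exchanged arguments its inverse. With R
  written in values of \<sigma>, all phases below are compared by the bicharacter rules.\<close>

lemma Rmat_eq: "Rmat \<theta> m n = sigma \<theta> n m * sigma \<theta> n m"
proof -
  have "inverse (sigma \<theta> m n) = sigma \<theta> n m"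
    using sigma_swap by (rule inverse_unique)
  then show ?thesis by (simp add: Rmat_sigma power2_eq_square)
qed

lemma sigma_zero_arg: "sigma \<theta> m 0 = 1" "sigma \<theta> 0 m = 1"
  by (cases m; simp add: zero_prod_def)+

lemma sigma_zero: "sigma 0 m n = 1"
  by (cases m; cases n) simp

lemma sigma_uminus: "sigma (- \<theta>) m n * sigma \<theta> m n = 1"
  by (cases m; cases n) (simp add: exp_add[symmetric])

declare sigma.simps [simp del] Rmat.simps [simp del]

section \<open>The twist map\<close>

text \<open>The map \<Phi> of the opening remarks.\<close>

definition twist :: "real \<Rightarrow> sphere2 \<Rightarrow> sphere2" where
  "twist \<theta> = tensor_lift (\<lambda>a a'. weight_sum (coact_K a) (\<lambda>m x. weight_sum (coact_K a') (\<lambda>n y.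
     sigma \<theta> m n *\<^sub>C (x \<otimes> y))))"

text \<open>The vertical map on all of \<open>sphere2\<close>, before passing to classes; it
  descends to one-forms by \<open>ver_rep_ker_mu_sq\<close>.\<close>

definition ver_rep :: "real \<Rightarrow> sphere2 \<Rightarrow> sphere" where
  "ver_rep \<theta> = tensor_lift (\<lambda>a a'. star \<theta> a (vert a'))"

lemma cbilinear_twist: "cbilinear (\<lambda>a a'. weight_sum (coact_K a) (\<lambda>m x. weight_sum (coact_K a') (\<lambda>n y.
     sigma \<theta> m n *\<^sub>C (x \<otimes> y))))"
  by (intro clin_intros)

lemma cbilinear_ver_rep: "cbilinear (\<lambda>a a'. star \<theta> a (vert a'))"
  by (intro clin_intros clin_vert)

lemma clin_twist: "clin f \<Longrightarrow> clin (\<lambda>x. twist \<theta> (f x))"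
  unfolding twist_def by (intro clin_intros)

lemma clin_ver_rep: "clin f \<Longrightarrow> clin (\<lambda>x. ver_rep \<theta> (f x))"
  unfolding ver_rep_def by (intro clin_intros clin_vert)

lemmas clin_rules = clin_intros clin_vert clin_delta2 clin_coact_K2 clin_coact_H2 clin_mu
  clin_lmult_left clin_lmult_right clin_rmult_left clin_rmult_right clin_braided_mult_left
  clin_braided_mult_right clin_twist clin_ver_rep

section \<open>Values on homogeneous tensors\<close>

lemma tensor_zero: "0 \<otimes> y = 0" "x \<otimes> 0 = 0"
  by (simp_all add: clinearD(3)[OF tensor_of_linear(1)] clinearD(3)[OF tensor_of_linear(2)])

lemma star_zero_arg: "star \<theta> 0 a = 0" "star \<theta> a 0 = 0"
  by (simp_all add: clinearD(3)[OF clin_star_left[OF clin_id]] clinearD(3)[OF clin_star_right[OF clin_id]])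

lemma star_hom: "hom m x \<Longrightarrow> hom n y \<Longrightarrow> star \<theta> x y = sigma \<theta> m n *\<^sub>C (x * y)"
  by (simp add: star_def homD weight_sum_single)

lemma hom_star: "hom m x \<Longrightarrow> hom n y \<Longrightarrow> hom (m + n) (star \<theta> x y)"
  by (simp add: star_hom hom_scaleC hom_mult)

lemma vert_hom: "hom m x \<Longrightarrow> vert x = of_int (h_weight m) *\<^sub>C x"
  by (simp add: vert_def homD weight_sum_single X_def)

lemma hom_vert: "hom m x \<Longrightarrow> hom m (vert x)"
  by (simp add: vert_hom hom_scaleC)

lemma twist_tensor: "hom m x \<Longrightarrow> hom n y \<Longrightarrow> twist \<theta> (x \<otimes> y) = sigma \<theta> m n *\<^sub>C (x \<otimes> y)"
  by (simp add: twist_def tensor_lift_tensor_of[OF cbilinear_twist] homD weight_sum_single tensor_zero)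

lemma mu_tensor: "mu \<theta> (x \<otimes> y) = star \<theta> x y"
  by (simp add: mu_def tensor_lift_tensor_of[OF star_bilinear])

lemma ver_rep_tensor: "ver_rep \<theta> (x \<otimes> y) = star \<theta> x (vert y)"
  by (simp add: ver_rep_def tensor_lift_tensor_of[OF cbilinear_ver_rep])

lemma lmult_tensor: "lmult \<theta> a (x \<otimes> y) = star \<theta> a x \<otimes> y"
  unfolding lmult_def by (rule tensor_lift_tensor_of) (intro clin_intros)

lemma rmult_tensor: "rmult \<theta> (x \<otimes> y) a = x \<otimes> star \<theta> y a"
  unfolding rmult_def by (rule tensor_lift_tensor_of) (intro clin_intros)

lemma braided_mult_tensor:
  assumes "hom m x" "hom n y" "hom m' x'" "hom n' y'"
  shows "braided_mult \<theta> (x \<otimes> y) (x' \<otimes> y') = Rmat \<theta> m' n *\<^sub>C (star \<theta> x x' \<otimes> star \<theta> y y')"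
  unfolding braided_mult_def
  by (subst tensor_lift_tensor_of[OF cbilinear_braided_mult],
      subst tensor_lift_tensor_of[OF cbilinear_braided_mult_aux])
    (simp add: homD[OF assms(3)] homD[OF assms(2)] weight_sum_single tensor_zero star_zero_arg)

lemmas scaleC_simps = clinearD(2)[OF clin_twist[OF clin_id]] clinearD(2)[OF clin_mu[OF clin_id]]
  clinearD(2)[OF clin_ver_rep[OF clin_id]] clinearD(2)[OF clin_lmult_left[OF clin_id]]
  clinearD(2)[OF clin_lmult_right[OF clin_id]] clinearD(2)[OF clin_rmult_left[OF clin_id]]
  clinearD(2)[OF clin_rmult_right[OF clin_id]] clinearD(2)[OF clin_braided_mult_left[OF clin_id]]
  clinearD(2)[OF clin_braided_mult_right[OF clin_id]] clinearD(2)[OF clin_coact_K2[OF clin_id]]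
  clinearD(2)[OF clin_coact_H2[OF clin_id]] clinearD(2)[OF clin_vert[OF clin_id]]
  clinearD(2)[OF clin_delta2[OF clin_id]] tensor_of_scale_left tensor_of_scale_right
  scaleC_sphere_mult sphere_mult_scaleC scaleC_scaleC single_scaleC

text \<open>The phase inserted by \<open>twist\<close> is the one that \<open>star\<close> inserts,
  and at \<theta> = 0 the product adds none.\<close>

lemma mu_twist: "mu 0 (twist \<theta> t) = mu \<theta> t"
  by (rule clin_eq_hom2; (intro clin_rules)?)
    (simp add: mu_tensor star_hom twist_tensor scaleC_simps sigma_zero)

text \<open>\<open>vert\<close> only rescales homogeneous elements, so \<open>star\<close> sees the
  same weights and the phases match as they do for \<open>mu\<close>.\<close>

lemma ver_rep_twist: "ver_rep 0 (twist \<theta> t) = ver_rep \<theta> t"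
  by (rule clin_eq_hom2; (intro clin_rules)?)
    (simp add: ver_rep_tensor star_hom[OF _ hom_vert] twist_tensor scaleC_simps sigma_zero)

lemma twist_uminus: "twist (- \<theta>) (twist \<theta> t) = t"
  by (rule clin_eq_hom2; (intro clin_rules)?)
    (simp add: twist_tensor scaleC_simps sigma_uminus mult.commute[of _ "sigma (- \<theta>) _ _"])

lemma twist_uminus': "twist \<theta> (twist (- \<theta>) t) = t"
  using twist_uminus[of "- \<theta>" t] by simp

lemma coact_H2_twist: "Poly_Mapping.lookup (coact_H2 (twist \<theta> t)) m = twist \<theta> (Poly_Mapping.lookup (coact_H2 t) m)"
  by (rule clin_eq_hom2; (intro clin_rules)?)
    (auto simp: twist_tensor scaleC_simps coact_H2_tensor lookup_single when_def
      clinearD(3)[OF clin_twist[OF clin_id]])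

lemma hom2_twist:
  assumes "hom2 m t"
  shows "hom2 m (twist \<theta> t)"
  unfolding hom2_def
  by (intro conjI; rule clin_eq_on_hom2[OF _ _ assms]; (intro clin_rules)?)
    (auto simp: twist_tensor scaleC_simps coact_K2_tensor coact_H2_tensor)

lemma hom2_lmult:
  assumes "hom2 m t" "hom n a"
  shows "hom2 (m + n) (lmult \<theta> a t)"
  unfolding hom2_def
  by (intro conjI; rule clin_eq_on_hom2[OF _ _ assms(1)]; (intro clin_rules)?)
    (simp_all add: lmult_tensor coact_K2_tensor[OF hom_star[OF assms(2)]]
        coact_H2_tensor[OF hom_star[OF assms(2)]] algebra_simps)

lemma hom2_rmult:
  assumes "hom2 m t" "hom n a"
  shows "hom2 (m + n) (rmult \<theta> t a)"
  unfolding hom2_def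
  by (intro conjI; rule clin_eq_on_hom2[OF _ _ assms(1)]; (intro clin_rules)?)
    (simp_all add: rmult_tensor coact_K2_tensor[OF _ hom_star[OF _ assms(2)]]
        coact_H2_tensor[OF _ hom_star[OF _ assms(2)]] algebra_simps)

lemma hom_ver_rep:
  assumes "hom2 m t"
  shows "hom m (ver_rep \<theta> t)"
  unfolding hom_def
  by (intro conjI; rule clin_eq_on_hom2[OF _ _ assms(1)]; (intro clin_rules)?)
    (auto simp: ver_rep_tensor homD[OF hom_star[OF _ hom_vert]])

text \<open>On a summand \<open>x \<otimes> y\<close> of weights p + q = m the phase is \<sigma>(n,
  p) \<sigma>(n + p, q) = \<sigma>(n, m) \<sigma>(p, q). The second factor belongs to
  \<open>twist \<theta> t\<close>; the first depends on the total weight alone.\<close>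

lemma twist_lmult:
  assumes "hom2 m t" "hom n a"
  shows "twist \<theta> (lmult \<theta> a t) = sigma \<theta> n m *\<^sub>C lmult 0 a (twist \<theta> t)"
  by (rule clin_eq_on_hom2[OF _ _ assms(1)]; (intro clin_rules)?)
    (simp add: lmult_tensor twist_tensor[OF hom_mult[OF assms(2)]] twist_tensor[OF hom_mult[OF _ assms(2)]]
      star_hom[OF assms(2)] twist_tensor
      scaleC_simps star_zero sigma_add_left sigma_add_right algebra_simps)

lemma twist_rmult:
  assumes "hom2 m t" "hom n a"
  shows "twist \<theta> (rmult \<theta> t a) = sigma \<theta> m n *\<^sub>C rmult 0 (twist \<theta> t) a"
  by (rule clin_eq_on_hom2[OF _ _ assms(1)]; (intro clin_rules)?)
    (simp add: rmult_tensor twist_tensor[OF _ hom_mult[OF assms(2)]] twist_tensor[OF _ hom_mult[OF _ assms(2)]]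
      star_hom[OF _ assms(2)] twist_tensor
      scaleC_simps star_zero sigma_add_left sigma_add_right algebra_simps)

text \<open>The braiding exchanges the arguments of \<sigma>. The spare factor \<open>c\<close> lets
  the identity act inside longer products of phases.\<close>

lemma Rmat_sigma_swap: "Rmat \<theta> m n * (sigma \<theta> m n * c) = sigma \<theta> n m * c"
  using sigma_swap[of \<theta> m n] unfolding Rmat_eq by (simp add: algebra_simps)

text \<open>This is where the braiding enters: R compensates for moving the middle factors past each
  other, and what remains is one phase in the total weights.\<close>

lemma twist_braided_mult:
  assumes "hom2 m s" "hom2 n t"
  shows "twist \<theta> (braided_mult \<theta> s t) = sigma \<theta> m n *\<^sub>C braided_mult 0 (twist \<theta> s) (twist \<theta> t)"
proof (rule clin_eq_on_hom2[OF _ _ assms(1)]; (intro clin_rules)?)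
  fix p p' x y assume xy: "hom p x" "hom p' y" "m = p + p'"
  show "twist \<theta> (braided_mult \<theta> (x \<otimes> y) t) = sigma \<theta> m n *\<^sub>C braided_mult 0 (twist \<theta> (x \<otimes> y)) (twist \<theta> t)"
  proof (rule clin_eq_on_hom2[OF _ _ assms(2)]; (intro clin_rules)?)
    fix q q' x' y' assume xy': "hom q x'" "hom q' y'" "n = q + q'"
    \<comment> \<open>R turns \<open>sigma \<theta> q p'\<close> into
      \<open>sigma \<theta> p' q\<close>, the cross term that is missing from
      \<open>sigma \<theta> m n\<close>.\<close>
    have "Rmat \<theta> q p' * (sigma \<theta> (p + q) (p' + q') * (sigma \<theta> p q * sigma \<theta> p' q')) =
      sigma \<theta> m n * (sigma \<theta> p p' * sigma \<theta> q q')"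
      using Rmat_sigma_swap[of \<theta> q p']
      by (simp add: sigma_add_left sigma_add_right xy(3) xy'(3) ac_simps)
    moreover have "twist \<theta> (braided_mult \<theta> (x \<otimes> y) (x' \<otimes> y')) =
        (Rmat \<theta> q p' * (sigma \<theta> (p + q) (p' + q') * (sigma \<theta> p q * sigma \<theta> p' q'))) *\<^sub>C ((x * x') \<otimes> (y * y'))"
      using xy xy' by (simp add: braided_mult_tensor star_hom scaleC_simps twist_tensor[OF hom_mult hom_mult] ac_simps)
    moreover have "sigma \<theta> m n *\<^sub>C braided_mult 0 (twist \<theta> (x \<otimes> y)) (twist \<theta> (x' \<otimes> y')) =
        (sigma \<theta> m n * (sigma \<theta> p p' * sigma \<theta> q q')) *\<^sub>C ((x * x') \<otimes> (y * y'))"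
      by (simp add: twist_tensor[OF xy(1,2)] twist_tensor[OF xy'(1,2)] braided_mult_zero scaleC_simps ac_simps)
    ultimately show "twist \<theta> (braided_mult \<theta> (x \<otimes> y) (x' \<otimes> y')) =
        sigma \<theta> m n *\<^sub>C braided_mult 0 (twist \<theta> (x \<otimes> y)) (twist \<theta> (x' \<otimes> y'))"
      by (simp only:)
  qed
qed

lemma hom2_braided_mult:
  assumes "hom2 m s" "hom2 n t"
  shows "hom2 (m + n) (braided_mult \<theta> s t)"
proof -
  have *: "coact_K2 (braided_mult \<theta> (x \<otimes> y) t) = Poly_Mapping.single (m + n) (braided_mult \<theta> (x \<otimes> y) t) \<and>
      coact_H2 (braided_mult \<theta> (x \<otimes> y) t) = Poly_Mapping.single (h_weight (m + n)) (braided_mult \<theta> (x \<otimes> y) t)"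
    if xy: "hom p x" "hom p' y" "m = p + p'" for p p' x y
    by (intro conjI; rule clin_eq_on_hom2[OF _ _ assms(2)]; (intro clin_rules)?)
      (simp_all add: xy(3) braided_mult_tensor[OF xy(1,2)] scaleC_simps
        coact_K2_tensor[OF hom_star[OF xy(1)] hom_star[OF xy(2)]]
        coact_H2_tensor[OF hom_star[OF xy(1)] hom_star[OF xy(2)]] ac_simps)
  show ?thesis unfolding hom2_def
    by (intro conjI; rule clin_eq_on_hom2[OF _ _ assms(1)]; (intro clin_rules)?) (simp_all only: *)
qed

section \<open>The kernel of the multiplication and its square\<close>

abbreviation tmult :: "sphere2 \<Rightarrow> sphere2 \<Rightarrow> sphere2" (infixl "\<odot>" 70) where
  "s \<odot> t \<equiv> braided_mult 0 s t"

lemma clin_subspace_vimage: "clin F \<Longrightarrow> csubspace S \<Longrightarrow> csubspace {x. F x \<in> S}"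
  by (rule cvec.subspaceI)
    (simp_all add: clinearD cvec.subspace_0 cvec.subspace_add cvec.subspace_scale)

lemma clin_span_mem:
  assumes "clin F" "csubspace S" "x \<in> cspan B" "\<And>x. x \<in> B \<Longrightarrow> F x \<in> S"
  shows "F x \<in> S"
  using cvec.span_induct[OF assms(3) clin_subspace_vimage[OF assms(1,2)]] assms(4) by blast

lemma csubspace_ker_mu: "csubspace (ker_mu \<theta>)"
  unfolding ker_mu_def
  by (rule cvec.subspaceI) (simp_all add: clinearD[OF clin_mu[OF clin_id]])

lemma csubspace_ker_mu_sq: "csubspace (ker_mu_sq \<theta>)"
  unfolding ker_mu_sq_def by (rule cvec.subspace_span)

lemma braided_mult_in_ker_mu_sq:
  "s \<in> ker_mu \<theta> \<Longrightarrow> t \<in> ker_mu \<theta> \<Longrightarrow> braided_mult \<theta> s t \<in> ker_mu_sq \<theta>"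
  unfolding ker_mu_sq_def by (rule cvec.span_base) blast

lemma ker_mu_sq_clin_mem:
  assumes "clin F" "csubspace S" "t \<in> ker_mu_sq \<theta>"
    and "\<And>s t. s \<in> ker_mu \<theta> \<Longrightarrow> t \<in> ker_mu \<theta> \<Longrightarrow> F (braided_mult \<theta> s t) \<in> S"
  shows "F t \<in> S"
  using assms(3) unfolding ker_mu_sq_def
  by (rule clin_span_mem[OF assms(1,2)]) (use assms(4) in blast)

text \<open>\<open>star\<close> changes a product of homogeneous elements only by a scalar, so
  \<open>mu\<close> respects weights; its kernel is graded for this reason.\<close>

lemma coact_K_mu: "Poly_Mapping.lookup (coact_K (mu \<theta> t)) m = mu \<theta> (Poly_Mapping.lookup (coact_K2 t) m)"
  by (rule clin_eq_hom2; (intro clin_rules)?)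
    (simp add: mu_tensor homD(1)[OF hom_star] coact_K2_tensor lookup_single when_def
      clinearD(3)[OF clin_mu[OF clin_id]])

lemma coact_K_ver_rep:
  "Poly_Mapping.lookup (coact_K (ver_rep \<theta> t)) m = ver_rep \<theta> (Poly_Mapping.lookup (coact_K2 t) m)"
  by (rule clin_eq_hom2; (intro clin_rules)?)
    (simp add: ver_rep_tensor homD(1)[OF hom_star[OF _ hom_vert]] coact_K2_tensor lookup_single when_def
      clinearD(3)[OF clin_ver_rep[OF clin_id]])

lemma graded_ker_mu: "graded (ker_mu \<theta>)"
  unfolding graded_def
proof (intro conjI ballI allI csubspace_ker_mu)
  fix t m assume "t \<in> ker_mu \<theta>"
  then show "Poly_Mapping.lookup (coact_K2 t) m \<in> ker_mu \<theta>"
    by (simp add: ker_mu_def clinearD(3)[OF clin_coact_K[OF clin_id]] flip: coact_K_mu)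
qed

text \<open>Both factors of a generating product may be taken homogeneous, because the kernel is
  graded and the braided product is linear in each factor. This makes
  \<open>twist_braided_mult\<close> applicable.\<close>

lemma ker_mu_sq_hom_mem:
  assumes "clin F" "csubspace S" "t \<in> ker_mu_sq \<theta>"
    and "\<And>m n s t. hom2 m s \<Longrightarrow> hom2 n t \<Longrightarrow> s \<in> ker_mu \<theta> \<Longrightarrow> t \<in> ker_mu \<theta> \<Longrightarrow>
      F (braided_mult \<theta> s t) \<in> S"
  shows "F t \<in> S"
proof (rule ker_mu_sq_clin_mem[OF assms(1-3)])
  fix s t assume st: "s \<in> ker_mu \<theta>" "t \<in> ker_mu \<theta>"
  show "F (braided_mult \<theta> s t) \<in> S"
  proof (rule graded_clin_mem[OF graded_ker_mu _ assms(2) st(1)])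
    show "clin (\<lambda>s. F (braided_mult \<theta> s t))"
      by (intro clin_compose[OF assms(1)] clin_rules)
    fix m s assume s: "hom2 m s" "s \<in> ker_mu \<theta>"
    show "F (braided_mult \<theta> s t) \<in> S"
    proof (rule graded_clin_mem[OF graded_ker_mu _ assms(2) st(2)])
      show "clin (\<lambda>t. F (braided_mult \<theta> s t))"
        by (intro clin_compose[OF assms(1)] clin_rules)
    qed (rule assms(4)[OF s(1) _ s(2)])
  qed
qed

lemma graded_ker_mu_sq: "graded (ker_mu_sq \<theta>)"
  unfolding graded_def
proof (intro conjI ballI allI csubspace_ker_mu_sq)
  fix t m assume "t \<in> ker_mu_sq \<theta>"
  then show "Poly_Mapping.lookup (coact_K2 t) m \<in> ker_mu_sq \<theta>"
  proof (rule ker_mu_sq_hom_mem[rotated 2])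
    show "csubspace (ker_mu_sq \<theta>)" by (rule csubspace_ker_mu_sq)
    show "clin (\<lambda>t. Poly_Mapping.lookup (coact_K2 t) m)" by (intro clin_rules)
    fix k n s t assume "hom2 k s" "hom2 n t" "s \<in> ker_mu \<theta>" "t \<in> ker_mu \<theta>"
    then show "Poly_Mapping.lookup (coact_K2 (braided_mult \<theta> s t)) m \<in> ker_mu_sq \<theta>"
      by (simp add: hom2D[OF hom2_braided_mult] lookup_single when_def braided_mult_in_ker_mu_sq
          cvec.subspace_0[OF csubspace_ker_mu_sq])
  qed
qed

lemma twist_ker_mu_iff: "twist \<theta> t \<in> ker_mu 0 \<longleftrightarrow> t \<in> ker_mu \<theta>"
  by (simp add: ker_mu_def mu_twist)

lemma twist_ker_mu_sq: "t \<in> ker_mu_sq \<theta> \<Longrightarrow> twist \<theta> t \<in> ker_mu_sq 0"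
proof (rule ker_mu_sq_hom_mem[OF clin_twist[OF clin_id] csubspace_ker_mu_sq])
  fix m n s t assume st: "hom2 m s" "hom2 n t" "s \<in> ker_mu \<theta>" "t \<in> ker_mu \<theta>"
  then show "twist \<theta> (braided_mult \<theta> s t) \<in> ker_mu_sq 0"
    by (simp add: twist_braided_mult[OF st(1,2)] cvec.subspace_scale[OF csubspace_ker_mu_sq]
        braided_mult_in_ker_mu_sq twist_ker_mu_iff)
qed

text \<open>Homogeneous factors in \<open>ker_mu 0\<close> are twists of homogeneous elements of
  \<open>ker_mu \<theta>\<close>. As phases do not vanish, \<open>twist_braided_mult\<close> can be
  solved for the undeformed product.\<close>

lemma twist_uminus_ker_mu_sq: "t \<in> ker_mu_sq 0 \<Longrightarrow> twist (- \<theta>) t \<in> ker_mu_sq \<theta>"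
proof (rule ker_mu_sq_hom_mem[OF clin_twist[OF clin_id] csubspace_ker_mu_sq])
  fix m n s t assume st: "hom2 m s" "hom2 n t" "s \<in> ker_mu 0" "t \<in> ker_mu 0"
  define s' t' where "s' = twist (- \<theta>) s" and "t' = twist (- \<theta>) t"
  have eq: "s = twist \<theta> s'" "t = twist \<theta> t'"
    by (simp_all add: s'_def t'_def twist_uminus')
  have ker: "s' \<in> ker_mu \<theta>" "t' \<in> ker_mu \<theta>"
    using st(3,4) by (simp_all add: eq twist_ker_mu_iff)
  have "hom2 m s'" "hom2 n t'"
    using st(1,2) by (simp_all add: s'_def t'_def hom2_twist)
  then have "s \<odot> t = twist \<theta> (inverse (sigma \<theta> m n) *\<^sub>C braided_mult \<theta> s' t')"
    by (simp add: scaleC_simps(1) twist_braided_mult eq scaleC_scaleC sigma_nonzero scaleC_one)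
  then show "twist (- \<theta>) (s \<odot> t) \<in> ker_mu_sq \<theta>"
    using ker by (simp add: twist_uminus cvec.subspace_scale[OF csubspace_ker_mu_sq] braided_mult_in_ker_mu_sq)
qed

lemma twist_ker_mu_sq_iff: "twist \<theta> t \<in> ker_mu_sq 0 \<longleftrightarrow> t \<in> ker_mu_sq \<theta>"
  using twist_ker_mu_sq[of t \<theta>] twist_uminus_ker_mu_sq[of "twist \<theta> t" \<theta>] by (auto simp: twist_uminus)

section \<open>Ideals and derivations in the undeformed tensor algebra\<close>

lemma tmult_assoc: "s \<odot> t \<odot> u = s \<odot> (t \<odot> u)"
proof (rule clin_eq_hom2[of "\<lambda>s. s \<odot> t \<odot> u" "\<lambda>s. s \<odot> (t \<odot> u)"]; (intro clin_rules)?)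
  fix x y show "(x \<otimes> y) \<odot> t \<odot> u = (x \<otimes> y) \<odot> (t \<odot> u)"
  proof (rule clin_eq_hom2[of "\<lambda>t. (x \<otimes> y) \<odot> t \<odot> u" "\<lambda>t. (x \<otimes> y) \<odot> (t \<odot> u)"]; (intro clin_rules)?)
    fix x' y' show "(x \<otimes> y) \<odot> (x' \<otimes> y') \<odot> u = (x \<otimes> y) \<odot> ((x' \<otimes> y') \<odot> u)"
      by (rule clin_eq_hom2; (intro clin_rules)?) (simp add: braided_mult_zero mult.assoc)
  qed
qed

lemma lmult_tmult: "lmult 0 a t = (a \<otimes> 1) \<odot> t"
  by (rule clin_eq_hom2; (intro clin_rules)?) (simp add: braided_mult_zero lmult_tensor star_zero)

text \<open>By commutativity of the undeformed algebra the right action is a product from the left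
  too, so ideal arguments cover both actions at once.\<close>

lemma rmult_tmult: "rmult 0 t a = (1 \<otimes> a) \<odot> t"
  by (rule clin_eq_hom2; (intro clin_rules)?) (simp add: braided_mult_zero rmult_tensor star_zero mult.commute)

lemma mu_tmult: "mu 0 (s \<odot> t) = mu 0 s * mu 0 t"
proof (rule clin_eq_hom2[of "\<lambda>s. mu 0 (s \<odot> t)" "\<lambda>s. mu 0 s * mu 0 t"]; (intro clin_rules)?)
  fix x y show "mu 0 ((x \<otimes> y) \<odot> t) = mu 0 (x \<otimes> y) * mu 0 t"
    by (rule clin_eq_hom2; (intro clin_rules)?) (simp add: braided_mult_zero mu_tensor star_zero ac_simps)
qed

text \<open>Weights add under multiplication, which makes the weight operator \<open>vert\<close> a
  derivation.\<close>

lemma vert_mult_hom: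
  assumes "hom m x" "hom n y"
  shows "vert (x * y) = vert x * y + x * vert y"
  by (simp add: vert_hom[OF hom_mult[OF assms]] vert_hom[OF assms(1)] vert_hom[OF assms(2)]
      scaleC_sphere_mult sphere_mult_scaleC flip: scaleC_add_left)

lemma vert_mult: "vert (a * b) = vert a * b + a * vert b"
proof (rule clin_eq_hom[of "\<lambda>a. vert (a * b)" "\<lambda>a. vert a * b + a * vert b"]; (intro clin_rules)?)
  fix m x assume x: "hom m x"
  show "vert (x * b) = vert x * b + x * vert b"
    by (rule clin_eq_hom[of "\<lambda>b. vert (x * b)"]; (intro clin_rules)?) (rule vert_mult_hom[OF x])
qed

text \<open>The vertical map is a derivation along \<open>mu 0\<close>, since \<open>vert\<close> is
  a derivation in the second tensor factor.\<close>

lemma ver_rep_tmult: "ver_rep 0 (s \<odot> t) = ver_rep 0 s * mu 0 t + mu 0 s * ver_rep 0 t"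
proof (rule clin_eq_hom2[of "\<lambda>s. ver_rep 0 (s \<odot> t)" "\<lambda>s. ver_rep 0 s * mu 0 t + mu 0 s * ver_rep 0 t"];
    (intro clin_rules)?)
  fix x y
  show "ver_rep 0 ((x \<otimes> y) \<odot> t) = ver_rep 0 (x \<otimes> y) * mu 0 t + mu 0 (x \<otimes> y) * ver_rep 0 t"
    by (rule clin_eq_hom2; (intro clin_rules)?)
      (simp add: braided_mult_zero mu_tensor star_zero ver_rep_tensor vert_mult algebra_simps)
qed

text \<open>In the Leibniz rule each summand carries a factor \<open>mu 0\<close> of an element of
  the kernel. The deformed case follows through \<open>twist\<close>.\<close>

lemma ver_rep_ker_mu_sq: "t \<in> ker_mu_sq \<theta> \<Longrightarrow> ver_rep \<theta> t = 0"
proof -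
  assume "t \<in> ker_mu_sq \<theta>"
  then have "ver_rep 0 (twist \<theta> t) \<in> {0}"
    by (intro ker_mu_sq_clin_mem[OF clin_ver_rep[OF clin_id] cvec.subspace_single_0 twist_ker_mu_sq])
      (auto simp: ver_rep_tmult ker_mu_def)
  then show ?thesis by (simp add: ver_rep_twist)
qed

lemma ker_mu_sq_subset: "t \<in> ker_mu_sq \<theta> \<Longrightarrow> t \<in> ker_mu \<theta>"
proof -
  assume "t \<in> ker_mu_sq \<theta>"
  then have "twist \<theta> t \<in> ker_mu 0"
    by (intro ker_mu_sq_clin_mem[OF clin_id csubspace_ker_mu twist_ker_mu_sq])
      (auto simp: mu_tmult ker_mu_def)
  then show ?thesis by (simp add: twist_ker_mu_iff)
qed

text \<open>The square of an ideal is an ideal: the outer factor is absorbed by the first factor of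
  a product, as \<open>mu 0\<close> is multiplicative.\<close>

lemma tmult_ker_mu_sq: "t \<in> ker_mu_sq 0 \<Longrightarrow> u \<odot> t \<in> ker_mu_sq 0"
proof (rule ker_mu_sq_clin_mem[OF clin_braided_mult_right[OF clin_id] csubspace_ker_mu_sq])
  fix s t assume st: "s \<in> ker_mu 0" "t \<in> ker_mu 0"
  then have "(u \<odot> s) \<odot> t \<in> ker_mu_sq 0"
    by (intro braided_mult_in_ker_mu_sq) (simp_all add: ker_mu_def mu_tmult)
  then show "u \<odot> (s \<odot> t) \<in> ker_mu_sq 0" by (simp add: tmult_assoc)
qed

lemma delta2_ker_mu: "delta2 a \<in> ker_mu 0"
  by (simp add: ker_mu_def delta2_def clin_diffD[OF clin_mu[OF clin_id]] mu_tensor star_zero)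

text \<open>The difference is the product of \<open>delta2 a\<close> with \<open>t\<close>, both in
  the kernel. So the two actions on Kaehler forms of the commutative algebra agree.\<close>

lemma lmult_rmult_diff:
  assumes "t \<in> ker_mu 0"
  shows "rmult 0 t a - lmult 0 a t \<in> ker_mu_sq 0"
proof -
  have "rmult 0 t a - lmult 0 a t = delta2 a \<odot> t"
    by (simp add: rmult_tmult lmult_tmult delta2_def clin_diffD[OF clin_braided_mult_left[OF clin_id]])
  then show ?thesis by (simp add: braided_mult_in_ker_mu_sq delta2_ker_mu assms)
qed

text \<open>Leibniz rule for the universal differential: its defect is exactly the product of
  \<open>delta2 a\<close> and \<open>delta2 b\<close>.\<close>

lemma delta2_mult: "delta2 (a * b) - (lmult 0 a (delta2 b) + lmult 0 b (delta2 a)) \<in> ker_mu_sq 0"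
proof -
  have "delta2 (a * b) - (lmult 0 a (delta2 b) + lmult 0 b (delta2 a)) = delta2 a \<odot> delta2 b"
    by (simp add: delta2_def clin_diffD[OF clin_braided_mult_left[OF clin_id]]
        clin_diffD[OF clin_braided_mult_right[OF clin_id]] clin_diffD[OF clin_lmult_right[OF clin_id]]
        braided_mult_zero lmult_tensor star_zero mult.commute[of b a])
  then show ?thesis by (simp add: braided_mult_in_ker_mu_sq delta2_ker_mu)
qed

section \<open>Cosets and the map between the spaces of connections\<close>

lemma coset_eq_iff:
  assumes "csubspace N"
  shows "s +o N = t +o N \<longleftrightarrow> s - t \<in> N"
proof
  assume "s +o N = t +o N"
  moreover have "s \<in> s +o N"
    using cvec.subspace_0[OF assms] by (auto simp: elt_set_plus_def)
  ultimately show "s - t \<in> N" by (auto simp: elt_set_plus_def)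
next
  assume st: "s - t \<in> N"
  have *: "s +o N \<subseteq> t +o N" if "s - t \<in> N" for s t
  proof
    fix x assume "x \<in> s +o N"
    then obtain y where y: "y \<in> N" "x = s + y" by (auto simp: elt_set_plus_def)
    then have "x = t + ((s - t) + y)" by simp
    then show "x \<in> t +o N"
      using cvec.subspace_add[OF assms that y(1)] unfolding elt_set_plus_def by blast
  qed
  show "s +o N = t +o N"
    using *[OF st] *[of t s] cvec.subspace_neg[OF assms st] by simp
qed

lemma rep_coset_diff: "csubspace N \<Longrightarrow> rep (t +o N) - t \<in> N"
proof -
  assume N: "csubspace N"
  have "t \<in> t +o N"
    using cvec.subspace_0[OF N] by (auto simp: elt_set_plus_def)
  then have "rep (t +o N) \<in> t +o N"
    unfolding rep_def by (rule someI)
  then show ?thesis by (auto simp: elt_set_plus_def)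
qed

lemma zero_coset: "0 +o N = (N :: 'a::comm_monoid_add set)"
  by (simp add: elt_set_plus_def)

lemma coset_add: "csubspace N \<Longrightarrow> (s +o N) + (t +o N) = (s + t) +o N"
proof -
  assume N: "csubspace N"
  have "N + N = N"
    using cvec.subspace_0[OF N] cvec.subspace_add[OF N] by (force simp: set_plus_def)
  then show ?thesis by (simp add: set_plus_rearrange)
qed

lemmas rep_diff = rep_coset_diff[OF csubspace_ker_mu_sq]

lemma Omega1E:
  assumes "\<eta> \<in> Omega1 \<theta>"
  obtains t where "t \<in> ker_mu \<theta>" "\<eta> = t +o ker_mu_sq \<theta>"
  using assms unfolding Omega1_def by blast

lemma rep_ker_mu:
  assumes "\<eta> \<in> Omega1 \<theta>"
  shows "rep \<eta> \<in> ker_mu \<theta>"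
proof -
  obtain t where t: "t \<in> ker_mu \<theta>" "\<eta> = t +o ker_mu_sq \<theta>"
    using assms by (rule Omega1E)
  from rep_diff[of t] have "rep \<eta> - t \<in> ker_mu \<theta>"
    unfolding t(2) by (rule ker_mu_sq_subset)
  from cvec.subspace_add[OF csubspace_ker_mu this t(1)] show ?thesis by simp
qed

lemma rep_Omega1:
  assumes "\<eta> \<in> Omega1 \<theta>"
  shows "rep \<eta> +o ker_mu_sq \<theta> = \<eta>"
proof -
  obtain t where t: "\<eta> = t +o ker_mu_sq \<theta>"
    using assms by (rule Omega1E)
  show ?thesis
    using rep_diff[of t] unfolding t by (simp add: coset_eq_iff[OF csubspace_ker_mu_sq])
qed

lemma coset_Omega1: "t \<in> ker_mu \<theta> \<Longrightarrow> t +o ker_mu_sq \<theta> \<in> Omega1 \<theta>"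
  by (auto simp: Omega1_def)

section \<open>Exact forms, and \<open>phi\<close> as the map induced by the twist\<close>

lemma hom2_delta2:
  assumes "hom m x"
  shows "hom2 m (delta2 x)"
  using hom2_diff[of m "1 \<otimes> x" "x \<otimes> 1"] hom2_tensor[OF hom_one assms] hom2_tensor[OF assms hom_one]
  by (simp add: delta2_def)

text \<open>The unit has weight zero and contributes no phase. Hence deformed and undeformed
  differentials have the same representatives.\<close>

lemma twist_delta2: "twist \<theta> (delta2 a) = delta2 a"
  by (rule clin_eq_hom; (intro clin_rules)?)
    (simp add: delta2_def clin_diffD[OF clin_twist[OF clin_id]] twist_tensor[OF hom_one]
      twist_tensor[OF _ hom_one] sigma_zero_arg scaleC_one)

lemma vert_one: "vert 1 = 0"
  using vert_hom[OF hom_one] by simp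

lemma ver_rep_delta2: "ver_rep 0 (delta2 a) = vert a"
  by (simp add: delta2_def clin_diffD[OF clin_ver_rep[OF clin_id]] ver_rep_tensor star_zero vert_one)

text \<open>Since \<open>delta2 y\<close> has the weight of \<open>y\<close>, the deformed action
  carries the phase of \<open>twist\<close>. The correction term comes from \<open>delta2 y\<close>
  containing \<open>y \<otimes> 1\<close>, and vanishes on the kernel of
  \<open>mu \<theta>\<close>.\<close>

lemma deformed_lmult_tensor_lift:
  "tensor_lift (\<lambda>a a'. deformed_lmult \<theta> a (delta2 a')) t = twist \<theta> t - mu \<theta> t \<otimes> 1"
proof -
  have bil: "cbilinear (\<lambda>a a'. deformed_lmult \<theta> a (delta2 a'))"
    unfolding deformed_lmult_def by (intro clin_rules)
  show ?thesis
  proof (rule clin_eq_hom2[of "tensor_lift (\<lambda>a a'. deformed_lmult \<theta> a (delta2 a'))"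
        "\<lambda>t. twist \<theta> t - mu \<theta> t \<otimes> 1"]; ((rule clin_tensor_lift_arg[OF bil clin_id]) | (intro clin_rules))?)
    fix m n x y assume xy: "hom m x" "hom n y"
    have "deformed_lmult \<theta> x (delta2 y) = sigma \<theta> m n *\<^sub>C lmult 0 x (delta2 y)"
      by (simp add: deformed_lmult_def homD[OF xy(1)] hom2D[OF hom2_delta2[OF xy(2)]] weight_sum_single
          clinearD(3)[OF clin_lmult_left[OF clin_id]] clinearD(3)[OF clin_lmult_right[OF clin_id]] )
    moreover have "lmult 0 x (delta2 y) = x \<otimes> y - (x * y) \<otimes> 1"
      by (simp add: delta2_def clin_diffD[OF clin_lmult_right[OF clin_id]] lmult_tensor star_zero)
    ultimately show "tensor_lift (\<lambda>a a'. deformed_lmult \<theta> a (delta2 a')) (x \<otimes> y) =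
        twist \<theta> (x \<otimes> y) - mu \<theta> (x \<otimes> y) \<otimes> 1"
      by (simp add: tensor_lift_tensor_of[OF bil] twist_tensor[OF xy] mu_tensor star_hom[OF xy] tensor_of_scale_left
          cvec.scale_right_diff_distrib)
  qed
qed

lemma phi_coset:
  assumes "t \<in> ker_mu \<theta>"
  shows "phi \<theta> (t +o ker_mu_sq \<theta>) = twist \<theta> t +o ker_mu_sq 0"
proof -
  let ?r = "rep (t +o ker_mu_sq \<theta>)"
  have "phi \<theta> (t +o ker_mu_sq \<theta>) = twist \<theta> ?r +o ker_mu_sq 0"
    using rep_ker_mu[OF coset_Omega1[OF assms]]
    by (simp add: phi_def on_forms_def deformed_lmult_tensor_lift ker_mu_def tensor_zero)
  also have "\<dots> = twist \<theta> t +o ker_mu_sq 0"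
    using rep_diff[of t]
    by (simp add: coset_eq_iff[OF csubspace_ker_mu_sq] twist_ker_mu_sq_iff
        flip: clin_diffD[OF clin_twist[OF clin_id]])
  finally show ?thesis .
qed

lemma ver_eq: "ver \<theta> \<eta> = ver_rep \<theta> (rep \<eta>)"
  by (simp add: ver_def on_forms_def ver_rep_def)

lemma ver_rep_cong: "s - t \<in> ker_mu_sq \<theta> \<Longrightarrow> ver_rep \<theta> s = ver_rep \<theta> t"
  using ver_rep_ker_mu_sq[of "s - t" \<theta>] by (simp add: clin_diffD[OF clin_ver_rep[OF clin_id]])

lemma H_comp_coset: "H_comp \<theta> (t +o ker_mu_sq \<theta>) n = Poly_Mapping.lookup (coact_H2 t) n +o ker_mu_sq \<theta>"
  using graded_lookup_H[OF graded_ker_mu_sq rep_diff[of t]]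
  by (simp add: H_comp_def coset_eq_iff[OF csubspace_ker_mu_sq] lookup_minus
      clin_diffD[OF clin_coact_H2[OF clin_id]])

lemma Con_coset_iff:
  assumes "t \<in> ker_mu \<theta>"
  shows "t +o ker_mu_sq \<theta> \<in> Con \<theta> \<longleftrightarrow> ver_rep \<theta> t = 1 \<and>
    (\<forall>n. Poly_Mapping.lookup (coact_H2 t) n - (if n = 0 then t else 0) \<in> ker_mu_sq \<theta>)"
proof -
  have "ver \<theta> (t +o ker_mu_sq \<theta>) = ver_rep \<theta> t"
    unfolding ver_eq by (rule ver_rep_cong[OF rep_diff])
  moreover have "(if n = 0 then t +o ker_mu_sq \<theta> else ker_mu_sq \<theta>) = (if n = 0 then t else 0) +o ker_mu_sq \<theta>"
    for n :: int by (simp add: zero_coset)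
  ultimately show ?thesis
    by (auto simp: Con_def coset_Omega1[OF assms] H_coinvariant_def H_comp_coset
        coset_eq_iff[OF csubspace_ker_mu_sq] simp del: if_split)
qed

lemma ConE:
  assumes "\<omega> \<in> Con \<theta>"
  obtains t where "t \<in> ker_mu \<theta>" "\<omega> = t +o ker_mu_sq \<theta>"
  using assms Omega1E unfolding Con_def by blast

text \<open>Each defining condition of a connection is preserved and reflected: \<open>twist\<close>
  intertwines the vertical maps, commutes with components under H and matches the squared
  kernels.\<close>

lemma Con_twist_iff:
  assumes "t \<in> ker_mu \<theta>"
  shows "twist \<theta> t +o ker_mu_sq 0 \<in> Con 0 \<longleftrightarrow> t +o ker_mu_sq \<theta> \<in> Con \<theta>"
proof -
  have "Poly_Mapping.lookup (coact_H2 (twist \<theta> t)) n - (if n = 0 then twist \<theta> t else 0) =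
      twist \<theta> (Poly_Mapping.lookup (coact_H2 t) n - (if n = 0 then t else 0))" for n
    by (simp add: clin_diffD[OF clin_twist[OF clin_id]] coact_H2_twist clinearD(3)[OF clin_twist[OF clin_id]])
  then show ?thesis
    using assms by (simp add: Con_coset_iff twist_ker_mu_iff ver_rep_twist twist_ker_mu_sq_iff)
qed

text \<open>Injectivity holds because \<open>twist\<close> reflects membership in the squared
  kernel; a preimage of the class of \<open>t\<close> is the class of
  \<open>twist (- \<theta>) t\<close>.\<close>

lemma bij_betw_phi: "bij_betw (phi \<theta>) (Con \<theta>) (Con 0)"
proof (rule bij_betwI')
  fix \<omega> \<omega>' assume "\<omega> \<in> Con \<theta>" "\<omega>' \<in> Con \<theta>"
  then obtain t t' where t: "t \<in> ker_mu \<theta>" "\<omega> = t +o ker_mu_sq \<theta>" "t' \<in> ker_mu \<theta>" "\<omega>' = t' +o ker_mu_sq \<theta>"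
    by (metis ConE)
  then show "phi \<theta> \<omega> = phi \<theta> \<omega>' \<longleftrightarrow> \<omega> = \<omega>'"
    by (simp add: phi_coset coset_eq_iff[OF csubspace_ker_mu_sq] twist_ker_mu_sq_iff
        flip: clin_diffD[OF clin_twist[OF clin_id]])
next
  fix \<omega> assume \<omega>: "\<omega> \<in> Con \<theta>"
  then obtain t where t: "t \<in> ker_mu \<theta>" "\<omega> = t +o ker_mu_sq \<theta>" by (rule ConE)
  then show "phi \<theta> \<omega> \<in> Con 0"
    using \<omega> by (simp add: phi_coset Con_twist_iff)
next
  fix \<omega> assume \<omega>: "\<omega> \<in> Con 0"
  then obtain t where t: "t \<in> ker_mu 0" "\<omega> = t +o ker_mu_sq 0" by (rule ConE)
  have t': "twist (- \<theta>) t \<in> ker_mu \<theta>"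
    using t(1) twist_ker_mu_iff[of \<theta> "twist (- \<theta>) t"] by (simp add: twist_uminus')
  then have "twist (- \<theta>) t +o ker_mu_sq \<theta> \<in> Con \<theta>" "\<omega> = phi \<theta> (twist (- \<theta>) t +o ker_mu_sq \<theta>)"
    using \<omega> t(2) Con_twist_iff[OF t'] by (simp_all add: phi_coset twist_uminus')
  then show "\<exists>\<omega>'\<in>Con \<theta>. \<omega> = phi \<theta> \<omega>'" by blast
qed

section \<open>The contraction of two-forms\<close>

text \<open>The formula of \<open>iota_pair\<close> on arbitrary tensors in place of chosen
  representatives of classes. In this form it is linear in each argument, which a choice by
  \<open>rep\<close> is not.\<close>

definition iota_rep :: "real \<Rightarrow> sphere \<Rightarrow> sphere2 \<Rightarrow> sphere2 \<Rightarrow> sphere2" where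
  "iota_rep \<theta> b s t = rmult \<theta> s (star \<theta> (ver_rep \<theta> t) b) -
     weight_sum (coact_K b) (\<lambda>m x. weight_sum (coact_K2 t) (\<lambda>n u.
       Rmat \<theta> m n *\<^sub>C lmult \<theta> (star \<theta> (ver_rep \<theta> s) x) u))"

lemma iota_pair_rep: "iota_pair \<theta> b \<eta> \<nu> = iota_rep \<theta> b (rep \<eta>) (rep \<nu>)"
  by (simp add: iota_pair_def iota_rep_def iota1_def ver_eq)

lemma clin_iota_rep:
  "clin f \<Longrightarrow> clin (\<lambda>z. iota_rep \<theta> (f z) s t)"
  "clin g \<Longrightarrow> clin (\<lambda>z. iota_rep \<theta> b (g z) t)"
  "clin g \<Longrightarrow> clin (\<lambda>z. iota_rep \<theta> b s (g z))"
  unfolding iota_rep_def by (intro clin_rules; assumption)+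

text \<open>Contraction reduces to \<theta> = 0 up to one phase: R(r, n) turns \<sigma>(r, n) into
  \<sigma>(n, r), and both summands then carry \<sigma>(m, n) \<sigma>(m, r) \<sigma>(n, r).\<close>

lemma twist_iota_rep:
  assumes b: "hom r b" and s: "hom2 m s" and t: "hom2 n t"
  shows "twist \<theta> (iota_rep \<theta> b s t) = (sigma \<theta> m n * sigma \<theta> (m + n) r) *\<^sub>C
    (rmult 0 (twist \<theta> s) (ver_rep 0 (twist \<theta> t) * b) - lmult 0 (ver_rep 0 (twist \<theta> s) * b) (twist \<theta> t))"
proof -
  have "iota_rep \<theta> b s t = sigma \<theta> n r *\<^sub>C rmult \<theta> s (ver_rep \<theta> t * b) -
      (Rmat \<theta> r n * sigma \<theta> m r) *\<^sub>C lmult \<theta> (ver_rep \<theta> s * b) t"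
    by (simp add: iota_rep_def homD[OF b] hom2D[OF t] weight_sum_single star_hom[OF hom_ver_rep[OF s] b]
        star_hom[OF hom_ver_rep[OF t] b] scaleC_simps star_zero_arg
        clinearD(3)[OF clin_lmult_left[OF clin_id]] clinearD(3)[OF clin_lmult_right[OF clin_id]])
  moreover have "Rmat \<theta> r n * (sigma \<theta> m r * sigma \<theta> (m + r) n) = sigma \<theta> m n * sigma \<theta> (m + n) r"
    using Rmat_sigma_swap[of \<theta> r n] by (simp add: sigma_add_left ac_simps)
  moreover have "sigma \<theta> n r * sigma \<theta> m (n + r) = sigma \<theta> m n * sigma \<theta> (m + n) r"
    by (simp add: sigma_add_left sigma_add_right)
  ultimately show ?thesis
    by (simp add: clin_diffD[OF clin_twist[OF clin_id]] scaleC_simps(1) twist_rmult[OF s hom_mult[OF hom_ver_rep[OF t] b]]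
        twist_lmult[OF t hom_mult[OF hom_ver_rep[OF s] b]] scaleC_scaleC ver_rep_twist cvec.scale_right_diff_distrib
        mult.assoc)
qed

text \<open>The common reduction for contractions: all three arguments may be homogeneous, where
  \<open>twist_iota_rep\<close> evaluates them, and the target moves to \<theta> = 0.\<close>

lemma trilinear_hom_mem:
  assumes U: "graded U" and V: "graded V" and st: "s \<in> U" "t \<in> V"
    and F: "\<And>s t. clin (\<lambda>b. F b s t)" "\<And>b t. clin (\<lambda>s. F b s t)" "\<And>b s. clin (\<lambda>t. F b s t)"
    and mem: "\<And>r m n b s t. hom r b \<Longrightarrow> hom2 m s \<Longrightarrow> hom2 n t \<Longrightarrow> s \<in> U \<Longrightarrow> t \<in> V \<Longrightarrow>
      twist \<theta> (F b s t) \<in> ker_mu_sq 0"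
  shows "F b s t \<in> ker_mu_sq \<theta>"
proof (rule hom_clin_mem[OF F(1) csubspace_ker_mu_sq])
  fix r b assume b: "hom r b"
  show "F b s t \<in> ker_mu_sq \<theta>"
  proof (rule graded_clin_mem[OF U F(2) csubspace_ker_mu_sq st(1)])
    fix m s assume s: "hom2 m s" "s \<in> U"
    show "F b s t \<in> ker_mu_sq \<theta>"
      by (rule graded_clin_mem[OF V F(3) csubspace_ker_mu_sq st(2)])
        (use mem[OF b s(1) _ s(2)] in \<open>simp add: twist_ker_mu_sq_iff\<close>)
  qed
qed

lemma graded_UNIV: "graded UNIV"
  by (simp add: graded_def cvec.subspace_UNIV)

lemma lmult_ker_mu_sq: "t \<in> ker_mu_sq 0 \<Longrightarrow> lmult 0 a t \<in> ker_mu_sq 0"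
  by (simp add: lmult_tmult tmult_ker_mu_sq)

lemma rmult_ker_mu_sq: "t \<in> ker_mu_sq 0 \<Longrightarrow> rmult 0 t a \<in> ker_mu_sq 0"
  by (simp add: rmult_tmult tmult_ker_mu_sq)

lemmas lmult_rmult_zero = clinearD(3)[OF clin_lmult_left[OF clin_id]] clinearD(3)[OF clin_lmult_right[OF clin_id]]
  clinearD(3)[OF clin_rmult_left[OF clin_id]] clinearD(3)[OF clin_rmult_right[OF clin_id]]

text \<open>The vertical part of \<open>s\<close> vanishes, and the other summand stays in the
  ideal. In the second slot the two summands exchange roles.\<close>

lemma iota_rep_ker_mu_sq_left: "s \<in> ker_mu_sq \<theta> \<Longrightarrow> iota_rep \<theta> b s t \<in> ker_mu_sq \<theta>"
  by (rule trilinear_hom_mem[where F = "iota_rep \<theta>", OF graded_ker_mu_sq graded_UNIV])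
    (auto intro!: clin_iota_rep clin_id cvec.subspace_scale[OF csubspace_ker_mu_sq]
      rmult_ker_mu_sq simp: twist_iota_rep ver_rep_ker_mu_sq twist_ker_mu_sq lmult_rmult_zero)

lemma iota_rep_ker_mu_sq_right: "t \<in> ker_mu_sq \<theta> \<Longrightarrow> iota_rep \<theta> b s t \<in> ker_mu_sq \<theta>"
  by (rule trilinear_hom_mem[where F = "iota_rep \<theta>", OF graded_UNIV graded_ker_mu_sq])
    (auto intro!: clin_iota_rep clin_id cvec.subspace_scale[OF csubspace_ker_mu_sq]
      cvec.subspace_neg[OF csubspace_ker_mu_sq]
      lmult_ker_mu_sq simp: twist_iota_rep ver_rep_ker_mu_sq twist_ker_mu_sq lmult_rmult_zero)

lemma iota_rep_cong:
  assumes "s - s' \<in> ker_mu_sq \<theta>" "t - t' \<in> ker_mu_sq \<theta>"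
  shows "iota_rep \<theta> b s t - iota_rep \<theta> b s' t' \<in> ker_mu_sq \<theta>"
proof -
  have "iota_rep \<theta> b s t - iota_rep \<theta> b s' t' = iota_rep \<theta> b (s - s') t + iota_rep \<theta> b s' (t - t')"
    by (simp add: clin_diffD[OF clin_iota_rep(2)[OF clin_id]] clin_diffD[OF clin_iota_rep(3)[OF clin_id]])
  then show ?thesis
    using assms by (simp add: cvec.subspace_add[OF csubspace_ker_mu_sq] iota_rep_ker_mu_sq_left
        iota_rep_ker_mu_sq_right)
qed

section \<open>Relations of the exterior algebra respected by the contraction\<close>

lemma ver_rep_lmult: "ver_rep 0 (lmult 0 a t) = a * ver_rep 0 t"
  by (simp add: lmult_tmult ver_rep_tmult ver_rep_tensor mu_tensor star_zero vert_one)

text \<open>The derivation rule also yields \<open>vert a * mu 0 t\<close>, which the hypothesis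
  removes.\<close>

lemma ver_rep_rmult: "t \<in> ker_mu 0 \<Longrightarrow> ver_rep 0 (rmult 0 t a) = a * ver_rep 0 t"
  by (simp add: rmult_tmult ver_rep_tmult mu_tensor star_zero ker_mu_def)

lemma lmult_lmult: "lmult 0 a (lmult 0 b t) = lmult 0 (a * b) t"
  by (simp add: lmult_tmult braided_mult_zero flip: tmult_assoc)

lemma rmult_rmult: "rmult 0 (rmult 0 t a) b = rmult 0 t (a * b)"
  by (simp add: rmult_tmult braided_mult_zero mult.commute flip: tmult_assoc)

text \<open>Compatibility with the tensor product over the deformed algebra. On homogeneous
  arguments the twisted contractions agree exactly: \<open>a\<close> joins both coefficients, and
  \<sigma>(m, p) \<sigma>(m + p, n) = \<sigma>(p, n) \<sigma>(m, p + n).\<close>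

lemma iota_rep_balanced:
  assumes "s \<in> ker_mu \<theta>" "t \<in> ker_mu \<theta>"
  shows "iota_rep \<theta> b (rmult \<theta> s a) t - iota_rep \<theta> b s (lmult \<theta> a t) \<in> ker_mu_sq \<theta>"
proof (rule hom_clin_mem[where a = a and F = "\<lambda>a. iota_rep \<theta> b (rmult \<theta> s a) t - iota_rep \<theta> b s (lmult \<theta> a t)",
      OF _ csubspace_ker_mu_sq])
  fix p a assume a: "hom p a"
  show "iota_rep \<theta> b (rmult \<theta> s a) t - iota_rep \<theta> b s (lmult \<theta> a t) \<in> ker_mu_sq \<theta>"
  proof (rule trilinear_hom_mem[where F = "\<lambda>b s t. iota_rep \<theta> b (rmult \<theta> s a) t - iota_rep \<theta> b s (lmult \<theta> a t)",
        OF graded_ker_mu graded_ker_mu assms]; (intro clin_rules clin_iota_rep)?)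
    fix r m n b s t
    assume b: "hom r b" and s: "hom2 m s" "s \<in> ker_mu \<theta>" and t: "hom2 n t" "t \<in> ker_mu \<theta>"
    show "twist \<theta> (iota_rep \<theta> b (rmult \<theta> s a) t - iota_rep \<theta> b s (lmult \<theta> a t)) \<in> ker_mu_sq 0"
      using s(2)
      by (simp add: clin_diffD[OF clin_twist[OF clin_id]] twist_iota_rep[OF b hom2_rmult[OF s(1) a] t(1)]
          twist_iota_rep[OF b s(1) hom2_lmult[OF t(1) a]] twist_rmult[OF s(1) a] twist_lmult[OF t(1) a]
          scaleC_simps ver_rep_lmult ver_rep_rmult twist_ker_mu_iff lmult_lmult rmult_rmult
          flip: cvec.scale_right_diff_distrib)
        (simp add: sigma_add_left sigma_add_right ac_simps cvec.subspace_0[OF csubspace_ker_mu_sq])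
  qed
qed (intro clin_rules clin_iota_rep)

text \<open>The factor R equalises the phases of the two contractions. Their four summands then pair
  up as a right action minus the left action of the same coefficient, covered by
  \<open>lmult_rmult_diff\<close>.\<close>

lemma iota_rep_braided_antisym:
  assumes "s \<in> ker_mu \<theta>" "t \<in> ker_mu \<theta>"
  shows "iota_rep \<theta> b s t + weight_sum (coact_K2 s) (\<lambda>m u. weight_sum (coact_K2 t) (\<lambda>n v.
    Rmat \<theta> n m *\<^sub>C iota_rep \<theta> b v u)) \<in> ker_mu_sq \<theta>" (is "?F b s t \<in> _")
proof (rule trilinear_hom_mem[where F = ?F, OF graded_ker_mu graded_ker_mu assms]; (intro clin_rules clin_iota_rep)?)
  fix r m n b s t
  assume b: "hom r b" and s: "hom2 m s" "s \<in> ker_mu \<theta>" and t: "hom2 n t" "t \<in> ker_mu \<theta>"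
  let ?S = "twist \<theta> s" and ?T = "twist \<theta> t"
  let ?c = "ver_rep 0 ?T * b" and ?c' = "ver_rep 0 ?S * b"
  have "?F b s t = iota_rep \<theta> b s t + Rmat \<theta> n m *\<^sub>C iota_rep \<theta> b t s"
    by (simp add: hom2D[OF s(1)] hom2D[OF t(1)] weight_sum_single clinearD(3)[OF clin_iota_rep(2)[OF clin_id]]
        clinearD(3)[OF clin_iota_rep(3)[OF clin_id]])
  moreover have "Rmat \<theta> n m * (sigma \<theta> n m * sigma \<theta> (n + m) r) = sigma \<theta> m n * sigma \<theta> (m + n) r"
    by (simp add: Rmat_sigma_swap add.commute)
  ultimately have "twist \<theta> (?F b s t) = (sigma \<theta> m n * sigma \<theta> (m + n) r) *\<^sub>C
      ((rmult 0 ?S ?c - lmult 0 ?c ?S) + (rmult 0 ?T ?c' - lmult 0 ?c' ?T))"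
    by (simp add: clinearD(1,2)[OF clin_twist[OF clin_id]] twist_iota_rep[OF b s(1) t(1)]
        twist_iota_rep[OF b t(1) s(1)] scaleC_scaleC scaleC_add_right cvec.scale_right_diff_distrib)
  then show "twist \<theta> (?F b s t) \<in> ker_mu_sq 0"
    using s(2) t(2)
    by (simp add: cvec.subspace_scale[OF csubspace_ker_mu_sq] cvec.subspace_add[OF csubspace_ker_mu_sq]
        lmult_rmult_diff twist_ker_mu_iff)
qed

section \<open>Descent of the contraction to two-forms\<close>

lemma clin_free_lift: "clin (free_lift f)"
  by (rule clinearI) (simp_all add: free_lift_add free_lift_scaleC)

lemma K_supp_subset: "K_supp \<theta> \<eta> \<subseteq> Poly_Mapping.keys (coact_K2 (rep \<eta>))"
proof
  fix m assume "m \<in> K_supp \<theta> \<eta>"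
  then show "m \<in> Poly_Mapping.keys (coact_K2 (rep \<eta>))"
    using zero_coset[of "ker_mu_sq \<theta>"] by (force simp: K_supp_def K_comp_def in_keys_iff)
qed

text \<open>Passage from tensors to classes. The supports of the classes can be smaller than those
  of the representatives, but the extra terms lie in \<open>ker_mu_sq \<theta>\<close>.\<close>

lemma iota_pair_braided_antisym:
  assumes "\<eta> \<in> Omega1 \<theta>" "\<nu> \<in> Omega1 \<theta>"
  shows "iota_pair \<theta> b \<eta> \<nu> + (\<Sum>m\<in>K_supp \<theta> \<eta>. \<Sum>n\<in>K_supp \<theta> \<nu>.
    Rmat \<theta> n m *\<^sub>C iota_pair \<theta> b (K_comp \<theta> \<nu> n) (K_comp \<theta> \<eta> m)) \<in> ker_mu_sq \<theta>"
proof -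
  let ?s = "rep \<eta>" and ?t = "rep \<nu>"
  let ?I = "Poly_Mapping.keys (coact_K2 ?s)" and ?J = "Poly_Mapping.keys (coact_K2 ?t)"
  define u where "u m = Poly_Mapping.lookup (coact_K2 ?s) m" for m
  define v where "v n = Poly_Mapping.lookup (coact_K2 ?t) n" for n
  define f where "f m n = Rmat \<theta> n m *\<^sub>C iota_rep \<theta> b (v n) (u m)" for m n
  define g where "g m n = Rmat \<theta> n m *\<^sub>C iota_pair \<theta> b (K_comp \<theta> \<nu> n) (K_comp \<theta> \<eta> m)" for m n
  have ext: "(\<Sum>n\<in>K_supp \<theta> \<nu>. h n) = (\<Sum>n\<in>Poly_Mapping.keys (coact_K2 (rep \<nu>)). if n \<in> K_supp \<theta> \<nu> then h n else 0)"
    for h :: "int \<times> int \<Rightarrow> sphere2" and \<nu>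
    using K_supp_subset[of \<theta> \<nu>] by (simp add: Int_absorb1 flip: sum.inter_restrict)
  have "f m n - (if m \<in> K_supp \<theta> \<eta> then if n \<in> K_supp \<theta> \<nu> then g m n else 0 else 0) \<in> ker_mu_sq \<theta>" for m n
  proof (cases "m \<in> K_supp \<theta> \<eta> \<and> n \<in> K_supp \<theta> \<nu>")
    case True
    have "iota_rep \<theta> b (rep (K_comp \<theta> \<nu> n)) (rep (K_comp \<theta> \<eta> m)) - iota_rep \<theta> b (v n) (u m) \<in> ker_mu_sq \<theta>"
      unfolding K_comp_def u_def v_def by (intro iota_rep_cong rep_diff)
    from cvec.subspace_neg[OF csubspace_ker_mu_sq this]
    have "iota_rep \<theta> b (v n) (u m) - iota_pair \<theta> b (K_comp \<theta> \<nu> n) (K_comp \<theta> \<eta> m) \<in> ker_mu_sq \<theta>"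
      by (simp add: iota_pair_rep)
    then show ?thesis
      using True by (simp add: f_def g_def cvec.subspace_scale[OF csubspace_ker_mu_sq]
          flip: cvec.scale_right_diff_distrib)
  next
    case False
    \<comment> \<open>Outside the support of a class, the component of its representative lies in
      the squared kernel, and contraction preserves this.\<close>
    have "u m \<in> ker_mu_sq \<theta> \<or> v n \<in> ker_mu_sq \<theta>"
    proof -
      have "u m \<in> ker_mu_sq \<theta>" if "m \<notin> K_supp \<theta> \<eta>"
        using that coset_eq_iff[OF csubspace_ker_mu_sq, of "u m" \<theta> 0]
        by (simp add: K_supp_def K_comp_def u_def zero_coset)
      moreover have "v n \<in> ker_mu_sq \<theta>" if "n \<notin> K_supp \<theta> \<nu>"
        using that coset_eq_iff[OF csubspace_ker_mu_sq, of "v n" \<theta> 0]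
        by (simp add: K_supp_def K_comp_def v_def zero_coset)
      ultimately show ?thesis using False by blast
    qed
    then have "f m n \<in> ker_mu_sq \<theta>"
      by (auto simp: f_def iota_rep_ker_mu_sq_left iota_rep_ker_mu_sq_right
          intro: cvec.subspace_scale[OF csubspace_ker_mu_sq])
    then show ?thesis using False by simp
  qed
  then have "(\<Sum>m\<in>?I. \<Sum>n\<in>?J. f m n - (if m \<in> K_supp \<theta> \<eta> then if n \<in> K_supp \<theta> \<nu> then g m n else 0 else 0))
      \<in> ker_mu_sq \<theta>"
    by (intro cvec.subspace_sum csubspace_ker_mu_sq)
  also have "(\<Sum>m\<in>?I. \<Sum>n\<in>?J. f m n - (if m \<in> K_supp \<theta> \<eta> then if n \<in> K_supp \<theta> \<nu> then g m n else 0 else 0)) =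
      (\<Sum>m\<in>?I. \<Sum>n\<in>?J. f m n) - (\<Sum>m\<in>K_supp \<theta> \<eta>. \<Sum>n\<in>K_supp \<theta> \<nu>. g m n)"
    unfolding ext sum_subtractf by (intro arg_cong2[of _ _ _ _ "(-)"] refl sum.cong) simp
  finally have diff: "(\<Sum>m\<in>?I. \<Sum>n\<in>?J. f m n) - (\<Sum>m\<in>K_supp \<theta> \<eta>. \<Sum>n\<in>K_supp \<theta> \<nu>. g m n) \<in> ker_mu_sq \<theta>" .
  have "iota_pair \<theta> b \<eta> \<nu> + (\<Sum>m\<in>?I. \<Sum>n\<in>?J. f m n) \<in> ker_mu_sq \<theta>"
    using iota_rep_braided_antisym[OF rep_ker_mu[OF assms(1)] rep_ker_mu[OF assms(2)], of b]
    by (simp add: weight_sum_def f_def u_def v_def iota_pair_rep)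
  from cvec.subspace_diff[OF csubspace_ker_mu_sq this diff] show ?thesis
    by (simp add: g_def)
qed

lemma star_scale_one: "star \<theta> (c *\<^sub>C 1) a = c *\<^sub>C a"
proof -
  have "star \<theta> 1 a = a"
    by (rule clin_eq_hom; (intro clin_rules)?) (simp add: star_hom[OF hom_one] sigma_zero_arg scaleC_one)
  then show ?thesis by (simp add: cbilinearD(3)[OF star_bilinear])
qed

lemma lmult_scale_one: "lmult \<theta> (c *\<^sub>C 1) t = c *\<^sub>C t"
  by (rule clin_eq_hom2; (intro clin_rules)?) (simp add: lmult_tensor star_scale_one tensor_of_scale_left)

text \<open>Makes the contraction of a two-form independent of its representative: the five families
  of relations are treated in turn.\<close>

lemma free_lift_iota_wedge_null:
  assumes "w \<in> wedge_null \<theta>"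
  shows "free_lift (\<lambda>(\<eta>, \<nu>). iota_pair \<theta> b \<eta> \<nu>) w \<in> ker_mu_sq \<theta>"
proof -
  note rules = cvec.subspace_0[OF csubspace_ker_mu_sq] free_lift_diff free_lift_add free_lift_single free_lift_scaleC
    scaleC_one iota_pair_rep clinearD(4)[OF clin_free_lift]
  note cong = iota_rep_cong[of _ _ \<theta>]
  have same: "x - x \<in> ker_mu_sq \<theta>" for x
    by (simp add: cvec.subspace_0[OF csubspace_ker_mu_sq])
  \<comment> \<open>A choice of representatives is additive only modulo the squared kernel.\<close>
  have rep_add: "rep (\<eta> + \<nu>) - (rep \<eta> + rep \<nu>) \<in> ker_mu_sq \<theta>" if "\<eta> \<in> Omega1 \<theta>" "\<nu> \<in> Omega1 \<theta>" for \<eta> \<nu>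
    using rep_diff[of "rep \<eta> + rep \<nu>" \<theta>] that
    by (simp add: rep_Omega1 flip: coset_add[OF csubspace_ker_mu_sq])
  let ?F = "free_lift (\<lambda>(\<eta>, \<nu>). iota_pair \<theta> b \<eta> \<nu>)"
  have left: "?F (pair (\<kappa> + \<eta>) \<nu> - pair \<kappa> \<nu> - pair \<eta> \<nu>) \<in> ker_mu_sq \<theta>"
    if "\<kappa> \<in> Omega1 \<theta>" "\<eta> \<in> Omega1 \<theta>" for \<kappa> \<eta> \<nu>
    using cong[OF rep_add[OF that] same[of "rep \<nu>"], of b]
    by (simp add: rules clinearD(1)[OF clin_iota_rep(2)[OF clin_id]] diff_diff_eq)
  have right: "?F (pair \<kappa> (\<eta> + \<nu>) - pair \<kappa> \<eta> - pair \<kappa> \<nu>) \<in> ker_mu_sq \<theta>"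
    if "\<eta> \<in> Omega1 \<theta>" "\<nu> \<in> Omega1 \<theta>" for \<kappa> \<eta> \<nu>
    using cong[OF same[of "rep \<kappa>"] rep_add[OF that], of b]
    by (simp add: rules clinearD(1)[OF clin_iota_rep(3)[OF clin_id]] diff_diff_eq)
  have scale: "?F (pair (lact \<theta> (c *\<^sub>C 1) \<eta>) \<nu> - c *\<^sub>C pair \<eta> \<nu>) \<in> ker_mu_sq \<theta>" for c \<eta> \<nu>
    using cong[OF rep_diff[of "c *\<^sub>C rep \<eta>"] same[of "rep \<nu>"], of b]
    by (simp add: rules lact_def lmult_scale_one clinearD(2)[OF clin_iota_rep(2)[OF clin_id]])
  have balance: "?F (pair (ract \<theta> \<eta> a) \<nu> - pair \<eta> (lact \<theta> a \<nu>)) \<in> ker_mu_sq \<theta>"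
    if "\<eta> \<in> Omega1 \<theta>" "\<nu> \<in> Omega1 \<theta>" for a \<eta> \<nu>
  proof -
    have "iota_rep \<theta> b (rmult \<theta> (rep \<eta>) a) (rep \<nu>) - iota_rep \<theta> b (rep \<eta>) (lmult \<theta> a (rep \<nu>)) \<in> ker_mu_sq \<theta>"
      by (intro iota_rep_balanced rep_ker_mu that)
    from cvec.subspace_add[OF csubspace_ker_mu_sq cong[OF rep_diff[of "rmult \<theta> (rep \<eta>) a"] same[of "rep \<nu>"], of b] this]
    have "iota_rep \<theta> b (rep (ract \<theta> \<eta> a)) (rep \<nu>) - iota_rep \<theta> b (rep \<eta>) (lmult \<theta> a (rep \<nu>)) \<in> ker_mu_sq \<theta>"
      by (simp add: ract_def)
    from cvec.subspace_diff[OF csubspace_ker_mu_sq this cong[OF same[of "rep \<eta>"] rep_diff[of "lmult \<theta> a (rep \<nu>)"], of b]]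
    show ?thesis
      by (simp add: rules lact_def)
  qed
  have braid: "?F (pair \<eta> \<nu> + (\<Sum>m\<in>K_supp \<theta> \<eta>. \<Sum>n\<in>K_supp \<theta> \<nu>.
           Rmat \<theta> n m *\<^sub>C pair (K_comp \<theta> \<nu> n) (K_comp \<theta> \<eta> m))) \<in> ker_mu_sq \<theta>"
    if "\<eta> \<in> Omega1 \<theta>" "\<nu> \<in> Omega1 \<theta>" for \<eta> \<nu>
    using iota_pair_braided_antisym[OF that, of b]
    by (simp add: free_lift_diff free_lift_add free_lift_single free_lift_scaleC
        scaleC_one clinearD(4)[OF clin_free_lift])
  show "free_lift (\<lambda>(\<eta>, \<nu>). iota_pair \<theta> b \<eta> \<nu>) w \<in> ker_mu_sq \<theta>"
    using assms unfolding wedge_null_def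
    by (rule clin_span_mem[OF clin_free_lift csubspace_ker_mu_sq])
      (elim UnE CollectE exE conjE; simp only: left right scale balance braid)
qed

section \<open>The action on connections\<close>

lemma clin_mem_on_hom2:
  assumes "clin F" "csubspace S" "hom2 M t"
    and "\<And>m n x y. hom m x \<Longrightarrow> hom n y \<Longrightarrow> M = m + n \<Longrightarrow> F (x \<otimes> y) \<in> S"
  shows "F t \<in> S"
proof -
  have "F (Poly_Mapping.lookup (coact_K2 t) M) \<in> S"
  proof (induction t rule: tensor_hom_induct)
    case (tensor m n x y)
    show ?case
      using assms(4)[OF tensor] cvec.subspace_0[OF assms(2)]
      by (simp add: coact_K2_tensor[OF tensor] lookup_single when_def clinearD(3)[OF assms(1)])
  next
    case (add s t)
    then show ?case
      by (simp add: clinearD(1)[OF clin_coact_K2[OF clin_id]] lookup_add clinearD(1)[OF assms(1)]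
          cvec.subspace_add[OF assms(2)])
  qed
  then show ?thesis by (simp add: hom2D[OF assms(3)])
qed

text \<open>A lift is a finite sum over one fixed representative, so a pointwise congruence
  suffices. This covers functions built with \<open>rep\<close>, which are not bilinear.\<close>

lemma tensor_lift_diff_mem:
  assumes "csubspace N" "\<And>x y. f x y - g x y \<in> N"
  shows "tensor_lift f t - tensor_lift g t \<in> N"
proof -
  have "tensor_lift (\<lambda>x y. f x y - g x y) t \<in> N"
    unfolding tensor_lift_def free_lift_def
    by (intro cvec.subspace_sum[OF assms(1)] cvec.subspace_scale[OF assms(1)])
      (simp add: assms(2) split: prod.split)
  then show ?thesis by (simp add: tensor_lift_diff_fun)
qed

text \<open>Cartan's formula at \<theta> = 0: the Lie derivative along X multiplies a form of weight
  \<open>M\<close> by its H-weight. Subtracting \<open>mu 0 T \<otimes> 1\<close> turns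
  \<open>x \<otimes> y\<close> into the representative of the form x dy, as \<open>T\<close> is not
  assumed in the kernel.\<close>

lemma iota_d_twisted:
  assumes T: "hom2 M T"
  shows "tensor_lift (\<lambda>x y. rmult 0 (delta2 x) (vert y * b) - lmult 0 (vert x * b) (delta2 y)) T -
    lmult 0 b (delta2 (ver_rep 0 T) - of_int (h_weight M) *\<^sub>C (T - mu 0 T \<otimes> 1)) \<in> ker_mu_sq 0"
    (is "tensor_lift ?q T - _ \<in> _")
proof -
  have bil: "cbilinear ?q" by (intro clin_rules)
  show ?thesis
  proof (rule clin_mem_on_hom2[OF _ csubspace_ker_mu_sq T]; (intro clin_rules)?)
    fix m n x y assume xy: "hom m x" "hom n y" "M = m + n"
    have lm: "lmult 0 x (delta2 y) = x \<otimes> y - (x * y) \<otimes> 1" for x y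
      by (simp add: delta2_def clin_diffD[OF clin_lmult_right[OF clin_id]] lmult_tensor star_zero)
    define c c' :: complex where "c = of_int (h_weight m)" and "c' = of_int (h_weight n)"
    have v: "vert x = c *\<^sub>C x" "vert y = c' *\<^sub>C y" "of_int (h_weight M) = c + c'"
      by (simp_all only: vert_hom[OF xy(1)] vert_hom[OF xy(2)] c_def c'_def xy(3)) simp
    \<comment> \<open>The terms with \<open>c\<close> cancel. What is left is c' times two defects:
      moving y b past dx, and the Leibniz rule for d(xy).\<close>
    define N where "N = c' *\<^sub>C ((rmult 0 (delta2 x) (y * b) - lmult 0 (y * b) (delta2 x)) -
      lmult 0 b (delta2 (x * y) - (lmult 0 x (delta2 y) + lmult 0 y (delta2 x))))"
    have "N \<in> ker_mu_sq 0"
      unfolding N_def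
      by (intro cvec.subspace_scale cvec.subspace_diff csubspace_ker_mu_sq lmult_rmult_diff delta2_ker_mu
          lmult_ker_mu_sq delta2_mult)
    moreover have "tensor_lift ?q (x \<otimes> y) - lmult 0 b (delta2 (ver_rep 0 (x \<otimes> y)) -
        of_int (h_weight M) *\<^sub>C ((x \<otimes> y) - mu 0 (x \<otimes> y) \<otimes> 1)) = N"
      unfolding v N_def
      by (simp add: tensor_lift_tensor_of[OF bil] v(1,2) ver_rep_tensor mu_tensor
          star_zero scaleC_simps clin_diffD[OF clin_lmult_right[OF clin_id]] clinearD(1)[OF clin_lmult_right[OF clin_id]]
          lmult_lmult scaleC_add_left cvec.scale_right_diff_distrib scaleC_add_right mult.commute[of b]
          flip: lm)
    ultimately show "tensor_lift ?q (x \<otimes> y) - lmult 0 b (delta2 (ver_rep 0 (x \<otimes> y)) -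
        of_int (h_weight M) *\<^sub>C ((x \<otimes> y) - mu 0 (x \<otimes> y) \<otimes> 1)) \<in> ker_mu_sq 0"
      by simp
  qed
qed

text \<open>The K-grading refines the H-grading. This carries H-coinvariance of a connection over to
  its K-components.\<close>

lemma coact_K2_coact_H2:
  "Poly_Mapping.lookup (coact_K2 (Poly_Mapping.lookup (coact_H2 t) (h_weight m))) m = Poly_Mapping.lookup (coact_K2 t) m"
  by (rule clin_eq_hom2; (intro clin_rules)?)
    (auto simp: coact_K2_tensor coact_H2_tensor lookup_single when_def clinearD(3)[OF clin_coact_K2[OF clin_id]])

lemma delta2_one: "delta2 1 = 0"
  by (simp add: delta2_def)

text \<open>Weight by weight, Cartan's formula leaves d of the vertical part, a component of 1 and
  hence killed by d, and the H-weight times the form, which vanishes modulo \<open>ker_mu_sq\<close>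
  by coinvariance.\<close>

lemma iota_d_connection:
  assumes t: "t \<in> ker_mu \<theta>" and con: "t +o ker_mu_sq \<theta> \<in> Con \<theta>"
  shows "tensor_lift (\<lambda>a a'. iota_rep \<theta> b (delta2 a) (delta2 a')) t \<in> ker_mu_sq \<theta>"
proof (rule hom_clin_mem[where F = "\<lambda>b. tensor_lift (\<lambda>a a'. iota_rep \<theta> b (delta2 a) (delta2 a')) t",
      OF _ csubspace_ker_mu_sq])
  show "clin (\<lambda>b. tensor_lift (\<lambda>a a'. iota_rep \<theta> b (delta2 a) (delta2 a')) t)"
    by (intro clin_rules clin_iota_rep)
  fix r b assume b: "hom r b"
  let ?D = "tensor_lift (\<lambda>a a'. iota_rep \<theta> b (delta2 a) (delta2 a'))"
  let ?Q = "tensor_lift (\<lambda>x y. rmult 0 (delta2 x) (vert y * b) - lmult 0 (vert x * b) (delta2 y))"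
  have bilD: "cbilinear (\<lambda>a a'. iota_rep \<theta> b (delta2 a) (delta2 a'))"
    by (intro clin_rules clin_iota_rep)
  have bilQ: "cbilinear (\<lambda>x y. rmult 0 (delta2 x) (vert y * b) - lmult 0 (vert x * b) (delta2 y))"
    by (intro clin_rules)
  note linD = clin_tensor_lift_arg[OF bilD clin_id] and linQ = clin_tensor_lift_arg[OF bilQ clin_id]
  \<comment> \<open>Components are treated separately because the phase
    \<open>sigma \<theta> M r\<close> depends on the weight.\<close>
  have comp: "?D (Poly_Mapping.lookup (coact_K2 t) M) \<in> ker_mu_sq \<theta>" for M
  proof -
    define u where "u = Poly_Mapping.lookup (coact_K2 t) M"
    have u: "hom2 M u"
      unfolding u_def by (rule hom2_comp)
    have "twist \<theta> (?D u) = sigma \<theta> M r *\<^sub>C ?Q (twist \<theta> u)"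
    proof (rule clin_eq_on_hom2[OF _ _ u, of "\<lambda>u. twist \<theta> (?D u)" "\<lambda>u. sigma \<theta> M r *\<^sub>C ?Q (twist \<theta> u)"])
      show "clin (\<lambda>u. twist \<theta> (?D u))" by (intro clin_twist linD)
      show "clin (\<lambda>u. sigma \<theta> M r *\<^sub>C ?Q (twist \<theta> u))"
        by (intro clin_scaleC clin_compose[OF linQ] clin_twist clin_id)
      fix m n x y assume xy: "hom m x" "hom n y" "M = m + n"
      show "twist \<theta> (?D (x \<otimes> y)) = sigma \<theta> M r *\<^sub>C ?Q (twist \<theta> (x \<otimes> y))"
        by (simp add: tensor_lift_tensor_of[OF bilD] twist_iota_rep[OF b hom2_delta2[OF xy(1)] hom2_delta2[OF xy(2)]]
            twist_delta2 ver_rep_delta2 twist_tensor[OF xy(1,2)] clinearD(2)[OF linQ] tensor_lift_tensor_of[OF bilQ]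
            scaleC_scaleC xy(3) mult.commute[of "sigma \<theta> m n"])
    qed
    moreover have "?Q (twist \<theta> u) \<in> ker_mu_sq 0"
    proof -
      define T where "T = twist \<theta> u"
      have T: "hom2 M T"
        unfolding T_def by (rule hom2_twist[OF u])
      have "u \<in> ker_mu \<theta>"
        using graded_ker_mu t unfolding u_def graded_def by blast
      then have mu: "mu 0 T = 0"
        by (simp add: T_def mu_twist ker_mu_def)
      have "ver_rep 0 T = Poly_Mapping.lookup (coact_K 1) M"
        using con by (simp add: T_def ver_rep_twist u_def Con_coset_iff[OF t] flip: coact_K_ver_rep)
      then have ver: "delta2 (ver_rep 0 T) = 0"
        by (simp add: coact_K_one lookup_single when_def delta2_one clinearD(3)[OF clin_delta2[OF clin_id]]
            del: single_one)
      \<comment> \<open>Either the scalar is zero, or coinvariance puts the whole H-component, and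
        with it \<open>u\<close>, in the squared kernel.\<close>
      have "of_int (h_weight M) *\<^sub>C T \<in> ker_mu_sq 0"
      proof (cases "h_weight M = 0")
        case False
        then have "Poly_Mapping.lookup (coact_H2 t) (h_weight M) \<in> ker_mu_sq \<theta>"
          using con unfolding Con_coset_iff[OF t] by (metis diff_zero)
        then have "u \<in> ker_mu_sq \<theta>"
          using graded_ker_mu_sq unfolding u_def graded_def coact_K2_coact_H2[of t M, symmetric] by blast
        then show ?thesis
          by (simp add: T_def twist_ker_mu_sq cvec.subspace_scale[OF csubspace_ker_mu_sq])
      qed (simp add: cvec.subspace_0[OF csubspace_ker_mu_sq])
      then have "lmult 0 b (delta2 (ver_rep 0 T) - of_int (h_weight M) *\<^sub>C (T - mu 0 T \<otimes> 1)) \<in> ker_mu_sq 0"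
        by (simp add: mu ver tensor_zero lmult_ker_mu_sq cvec.subspace_neg[OF csubspace_ker_mu_sq] del: of_int_add)
      from cvec.subspace_add[OF csubspace_ker_mu_sq iota_d_twisted[OF T, of b] this] show ?thesis
        by (simp add: T_def)
    qed
    ultimately have "twist \<theta> (?D u) \<in> ker_mu_sq 0"
      by (simp add: cvec.subspace_scale[OF csubspace_ker_mu_sq])
    then show ?thesis
      by (simp add: twist_ker_mu_sq_iff u_def)
  qed
  have "?D t = ?D (weight_sum (coact_K2 t) (\<lambda>m x. x))"
    by (simp add: coact_K2_counit)
  also have "\<dots> \<in> ker_mu_sq \<theta>"
    unfolding weight_sum_def clinearD(4)[OF linD] by (intro cvec.subspace_sum csubspace_ker_mu_sq comp)
  finally show "?D t \<in> ker_mu_sq \<theta>" .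
qed

text \<open>Chosen representatives are removed layer by layer: first that of the two-form, then
  those of the exact one-forms. What remains is minus the expression of
  \<open>iota_d_connection\<close>.\<close>

lemma iota2_d1_connection:
  assumes "\<omega> \<in> Con \<theta>"
  shows "iota2 \<theta> b (d1 \<theta> \<omega>) = ker_mu_sq \<theta>"
proof -
  let ?F = "free_lift (\<lambda>(\<eta>, \<nu>). iota_pair \<theta> b \<eta> \<nu>)" and ?t = "rep \<omega>"
  let ?W = "tensor_lift (\<lambda>a a'. - pair (d0 \<theta> a) (d0 \<theta> a')) ?t"
  have \<omega>: "\<omega> \<in> Omega1 \<theta>" using assms by (simp add: Con_def)
  have null: "csubspace (wedge_null \<theta>)"
    unfolding wedge_null_def by (rule cvec.subspace_span)
  have 1: "?F (rep (d1 \<theta> \<omega>)) - ?F ?W \<in> ker_mu_sq \<theta>"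
    using free_lift_iota_wedge_null[OF rep_coset_diff[OF null]]
    by (simp add: d1_def on_forms_def free_lift_diff)
  have 2: "?F ?W = tensor_lift (\<lambda>a a'. - iota_rep \<theta> b (rep (d0 \<theta> a)) (rep (d0 \<theta> a'))) ?t"
    unfolding tensor_lift_comp_linear[OF clin_free_lift, symmetric]
    by (simp add: clin_diffD[OF clin_free_lift] free_lift_single scaleC_one iota_pair_rep)
  have 3: "\<dots> - tensor_lift (\<lambda>a a'. - iota_rep \<theta> b (delta2 a) (delta2 a')) ?t \<in> ker_mu_sq \<theta>"
  proof (rule tensor_lift_diff_mem[OF csubspace_ker_mu_sq])
    fix x y
    have "iota_rep \<theta> b (rep (d0 \<theta> x)) (rep (d0 \<theta> y)) - iota_rep \<theta> b (delta2 x) (delta2 y) \<in> ker_mu_sq \<theta>"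
      unfolding d0_def by (intro iota_rep_cong rep_diff)
    from cvec.subspace_neg[OF csubspace_ker_mu_sq this]
    show "- iota_rep \<theta> b (rep (d0 \<theta> x)) (rep (d0 \<theta> y)) - - iota_rep \<theta> b (delta2 x) (delta2 y) \<in> ker_mu_sq \<theta>"
      by simp
  qed
  have 4: "tensor_lift (\<lambda>a a'. - iota_rep \<theta> b (delta2 a) (delta2 a')) ?t \<in> ker_mu_sq \<theta>"
    using iota_d_connection[OF rep_ker_mu[OF \<omega>], of b] assms
    by (simp add: tensor_lift_comp_linear[OF clin_uminus[OF clin_id]] rep_Omega1[OF \<omega>]
        cvec.subspace_neg[OF csubspace_ker_mu_sq])
  have "?F (rep (d1 \<theta> \<omega>)) \<in> ker_mu_sq \<theta>"
    using cvec.subspace_add[OF csubspace_ker_mu_sq 1[unfolded 2] cvec.subspace_add[OF csubspace_ker_mu_sq 3 4]]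
    by simp
  then show ?thesis
    using coset_eq_iff[OF csubspace_ker_mu_sq, of _ \<theta> 0] by (simp add: iota2_def zero_coset)
qed

text \<open>The term with the differential of \<omega> drops out, and the normalisation
  \<open>ver \<theta> \<omega> = 1\<close> reduces the contraction of \<omega> to
  \<open>b\<close>.\<close>

lemma gauge_act_connection:
  assumes "\<omega> \<in> Con \<theta>"
  shows "gauge_act \<theta> \<omega> b = d0 \<theta> b"
proof -
  have "star \<theta> 1 b = b"
    using star_scale_one[of \<theta> 1 b] by (simp add: scaleC_one)
  then have "iota1 \<theta> b \<omega> = b"
    using assms by (simp add: iota1_def Con_def)
  then show ?thesis
    using coset_add[OF csubspace_ker_mu_sq, of "delta2 b" \<theta> 0]
    by (simp add: gauge_act_def iota2_d1_connection[OF assms] d0_def zero_coset)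
qed

lemma phi_d0: "phi \<theta> (d0 \<theta> b) = d0 0 b"
proof -
  have "delta2 b \<in> ker_mu \<theta>"
    using delta2_ker_mu[of b] twist_ker_mu_iff[of \<theta> "delta2 b"] by (simp add: twist_delta2)
  then show ?thesis by (simp add: d0_def phi_coset twist_delta2)
qed

theorem proposition4p21:
  fixes \<theta> :: real
  shows "bij_betw (phi \<theta>) (Con \<theta>) (Con 0) \<and>
    (\<forall>b \<in> base. \<forall>\<omega> \<in> Con \<theta>. phi \<theta> (gauge_act \<theta> \<omega> b) = gauge_act 0 (phi \<theta> \<omega>) b)"
  \<comment> \<open>\<open>phi\<close> lands in \<open>Con 0\<close>, so both actions are exact
    forms of \<open>b\<close>, and \<open>phi_d0\<close> matches them.\<close>
  using bij_betwE[OF bij_betw_phi] bij_betw_phi by (simp add: gauge_act_connection phi_d0)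

end
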